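(* For every matrix $M\in\mathbb{R}^{d\times n}$ (with $d,n\ge 1$), $$\text{tropical rank}(M)\;\le\;\text{Kapranov rank}(M)\;\le\;\text{Barvinok rank}(M).$$ Both of these inequalities can be strict; that is, there exists a real matrix whose tropical rank is strictly smaller than its Kapranov rank, and there exists a real matrix whose Kapranov rank is strictly smaller than its Barvinok rank.
   Context: The tropical semiring is $(\mathbb{R},\oplus,\odot)$ with $a\oplus b=\min(a,b)$ and $a\odot b=a+b$. Tropical sums and products of matrices are defined with these operations. Barvinok rank: the Barvinok rank of $M\in\mathbb{R}^{d\times n}$ is the smallest integer $r$ such that $M$ is the tropical sum (entrywise minimum) of $r$ matrices, each of which is the tropical product of a $d\times 1$ real matrix and a $1\times n$ real matrix (i.e. has entries $x_i+y_j$). Tropical rank: a square matrix $(m_{ij})\in\mathbb{R}^{r\times r}$ is tropically singular if the minimum $\min_{\sigma\in\mathcal{S}_r}(m_{1\sigma_1}+\cdots+m_{r\sigma_r})$ over all permutations is attained by at least two permutations; otherwise it is tropically non-singular. The tropical rank of $M$ is the largest $r$ such that $M$ has a tropically non-singular $r\times r$ submatrix. Kapranov rank: let $\tilde K$ be the field of formal power series $f=\sum_a c_a t^a$ with complex coefficients and real exponents, with well-ordered support; for $f\ne 0$ let $\deg(f)$ be the smallest exponent $a$ with $c_a\neq 0$. A tropical linear space in $\mathbb{R}^d$ is a set of the form $\{(\deg f_1,\dots,\deg f_d) : (f_1,\dots,f_d)\in V,\ \text{all } f_i\ne 0\}$, where $V$ is a linear subspace of $\tilde K^d$ (equivalently,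 the common zero set of linear forms $a_1x_1+\cdots+a_dx_d$ with coefficients in $\tilde K$); its dimension is $\dim_{\tilde K}V$. The Kapranov rank of $M$ is the smallest dimension of a tropical linear space in $\mathbb{R}^d$ containing all columns of $M$. *)

theory Defs
  imports Complex_Main "Jordan_Normal_Form.DL_Rank" "Jordan_Normal_Form.DL_Submatrix"
begin

section \<open>Power series with real exponents and well-ordered support\<close>

text \<open>On the reals, well-foundedness of \<open><\<close> on a set says that the set is well-ordered.\<close>

typedef hahn = "{f :: real \<Rightarrow> complex. wfp_on {a. f a \<noteq> 0} (<)}"
  morphisms hahn_coeff Hahn
  by (rule exI[of _ "\<lambda>_. 0"]) (simp add: wfp_on_iff_ex_minimal)

lemma wfp_hahn_coeff: "wfp_on {a. hahn_coeff f a \<noteq> 0} (<)"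
  using hahn_coeff[of f] by simp

lemma hahn_coeff_Hahn: "wfp_on {a. f a \<noteq> 0} (<) \<Longrightarrow> hahn_coeff (Hahn f) = f"
  by (simp add: Hahn_inverse)

lemma hahn_eqI: "(\<And>a. hahn_coeff f a = hahn_coeff g a) \<Longrightarrow> f = g"
  using hahn_coeff_inject[of f g] by (simp add: fun_eq_iff)

lemma wfp_real_iff:
  fixes S :: "real set"
  shows "wfp_on S (<) \<longleftrightarrow> (\<nexists>s. (\<forall>n::nat. s n \<in> S) \<and> (\<forall>n. s (Suc n) < s n))"
proof
  assume w: "wfp_on S (<)"
  show "\<nexists>s. (\<forall>n::nat. s n \<in> S) \<and> (\<forall>n. s (Suc n) < s n)"
  proof
    assume "\<exists>s. (\<forall>n::nat. s n \<in> S) \<and> (\<forall>n. s (Suc n) < s n)"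
    then obtain s where s: "\<And>n::nat. s n \<in> S" "\<And>n. s (Suc n) < s n" by blast
    have "range s \<subseteq> S" "range s \<noteq> {}" using s by auto
    then obtain z where "z \<in> range s" "\<And>y. y < z \<Longrightarrow> y \<notin> range s"
      using w unfolding wfp_on_iff_ex_minimal by meson
    then show False using s(2) by blast
  qed
next
  assume n: "\<nexists>s. (\<forall>n::nat. s n \<in> S) \<and> (\<forall>n. s (Suc n) < s n)"
  show "wfp_on S (<)"
  proof (rule ccontr)
    assume "\<not> wfp_on S (<)"
    then obtain B where B: "B \<subseteq> S" "B \<noteq> {}" "\<not> (\<exists>z\<in>B. \<forall>y. y < z \<longrightarrow> y \<notin> B)"
      unfolding wfp_on_iff_ex_minimal not_all not_imp by (elim exE conjE)
    obtain b where b: "b \<in> B" using B(2) by blast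
    have "\<exists>s. \<forall>n::nat. s n \<in> B \<and> s (Suc n) < s n"
    proof (rule dependent_nat_choice)
      show "\<exists>x. x \<in> B" using b by blast
    next
      fix x and n :: nat
      assume "x \<in> B"
      then show "\<exists>y. y \<in> B \<and> y < x" using B(3) by blast
    qed
    then obtain s where "\<forall>n::nat. s n \<in> B \<and> s (Suc n) < s n" by (elim exE)
    then have "(\<forall>n. s n \<in> S) \<and> (\<forall>n. s (Suc n) < s n)" using B(1) by auto
    then show False using n by (metis (no_types))
  qed
qed

lemma wfp_realD:
  fixes S :: "real set"
  assumes "wfp_on S (<)" "\<And>n::nat. s n \<in> S" "\<And>n. s (Suc n) < s n"
  shows False
  using assms wfp_real_iff by blast

lemma wfp_incseq_subseq:
  fixes s :: "nat \<Rightarrow> real"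
  assumes w: "wfp_on S (<)" and s: "\<And>n. s n \<in> S"
  shows "\<exists>r. strict_mono r \<and> incseq (s \<circ> r)"
proof -
  obtain r where r: "strict_mono r" "monoseq (\<lambda>n. s (r n))"
    using seq_monosub[of s] by (auto simp: o_def)
  show ?thesis
  proof (cases "incseq (\<lambda>n. s (r n))")
    case True
    then show ?thesis using r by (auto simp: o_def)
  next
    case False
    then have d: "decseq (\<lambda>n. s (r n))" using r(2) by (simp add: monoseq_iff)
    have "range (\<lambda>n. s (r n)) \<subseteq> S" "range (\<lambda>n. s (r n)) \<noteq> {}" using s by auto
    then obtain z where z: "z \<in> range (\<lambda>n. s (r n))"
        "\<And>y. y < z \<Longrightarrow> y \<notin> range (\<lambda>n. s (r n))"
      using w unfolding wfp_on_iff_ex_minimal by meson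
    then obtain N where N: "z = s (r N)" by auto
    have c: "s (r (n + N)) = z" for n
    proof -
      have "s (r (n + N)) \<le> z" using d N by (simp add: decseq_def)
      moreover have "\<not> s (r (n + N)) < z" using z(2) by blast
      ultimately show ?thesis by simp
    qed
    have "strict_mono (\<lambda>n. r (n + N))" using r(1) by (simp add: strict_mono_def)
    moreover have "incseq (s \<circ> (\<lambda>n. r (n + N)))" using c by (simp add: incseq_def)
    ultimately show ?thesis by blast
  qed
qed

lemma wfp_Un:
  fixes S T :: "real set"
  assumes "wfp_on S (<)" "wfp_on T (<)"
  shows "wfp_on (S \<union> T) (<)"
  unfolding wfp_on_iff_ex_minimal
proof (intro allI impI)
  fix B assume B: "B \<subseteq> S \<union> T" "B \<noteq> {}"
  show "\<exists>z\<in>B. \<forall>y. y < z \<longrightarrow> y \<notin> B"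
  proof (cases "B \<inter> S = {} \<or> B \<inter> T = {}")
    case True
    then have "B \<subseteq> S \<or> B \<subseteq> T" using B by blast
    then show ?thesis using B(2) assms unfolding wfp_on_iff_ex_minimal by meson
  next
    case False
    obtain x where x: "x \<in> B \<inter> S" "\<And>y. y < x \<Longrightarrow> y \<notin> B \<inter> S"
      using assms(1) False unfolding wfp_on_iff_ex_minimal by (meson Int_lower2)
    obtain x' where x': "x' \<in> B \<inter> T" "\<And>y. y < x' \<Longrightarrow> y \<notin> B \<inter> T"
      using assms(2) False unfolding wfp_on_iff_ex_minimal by (meson Int_lower2)
    have "min x x' \<in> B" using x x' by (simp add: min_def)
    moreover have "y \<notin> B" if "y < min x x'" for y
      using that x(2)[of y] x'(2)[of y] B by auto
    ultimately show ?thesis by blast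
  qed
qed

definition sumset :: "real set \<Rightarrow> real set \<Rightarrow> real set" where
  "sumset S T = {a + b |a b. a \<in> S \<and> b \<in> T}"

lemma sumsetI: "a \<in> S \<Longrightarrow> b \<in> T \<Longrightarrow> c = a + b \<Longrightarrow> c \<in> sumset S T"
  unfolding sumset_def by blast

lemma wfp_sumset:
  assumes S: "wfp_on S (<)" and T: "wfp_on T (<)"
  shows "wfp_on (sumset S T) (<)"
  unfolding wfp_real_iff
proof
  assume "\<exists>s. (\<forall>n::nat. s n \<in> sumset S T) \<and> (\<forall>n. s (Suc n) < s n)"
  then obtain s where s: "\<And>n::nat. s n \<in> sumset S T" "\<And>n. s (Suc n) < s n" by blast
  have "\<forall>n. \<exists>a b. s n = a + b \<and> a \<in> S \<and> b \<in> T" using s(1) unfolding sumset_def by blast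
  then obtain a b where ab: "\<And>n. s n = a n + b n" "\<And>n. a n \<in> S" "\<And>n. b n \<in> T" by metis
  obtain r where r: "strict_mono r" "incseq (a \<circ> r)"
    using wfp_incseq_subseq[where s = a, OF S ab(2)] by (elim exE conjE)
  have dec: "s m < s n" if "n < m" for m n
    using that
  proof (induction m)
    case (Suc m)
    then show ?case using s(2)[of m] by (cases "n = m") auto
  qed simp
  have "b (r (Suc n)) < b (r n)" for n
  proof -
    have "s (r (Suc n)) < s (r n)" using dec r(1) by (simp add: strict_mono_Suc_iff)
    moreover have "a (r n) \<le> a (r (Suc n))" using r(2) by (simp add: incseq_Suc_iff)
    ultimately show ?thesis using ab(1) by (smt (verit))
  qed
  then show False using wfp_realD[OF T, of "\<lambda>n. b (r n)"] ab(3) by blast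
qed

lemma finite_conv:
  assumes S: "wfp_on S (<)" and T: "wfp_on T (<)"
  shows "finite {a \<in> S. c - a \<in> (T :: real set)}"
proof (rule ccontr)
  assume "infinite {a \<in> S. c - a \<in> T}"
  then obtain s :: "nat \<Rightarrow> real" where s: "inj s" "range s \<subseteq> {a \<in> S. c - a \<in> T}"
    using infinite_countable_subset by blast
  then have sS: "\<And>n. s n \<in> S" and sT: "\<And>n. c - s n \<in> T" by auto
  obtain r where r: "strict_mono r" "incseq (s \<circ> r)"
    using wfp_incseq_subseq[where s = s, OF S sS] by (elim exE conjE)
  have "s (r n) < s (r (Suc n))" for n
  proof -
    have "s (r n) \<le> s (r (Suc n))" using r(2) by (simp add: incseq_Suc_iff)
    moreover have "s (r n) \<noteq> s (r (Suc n))"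
      using s(1) r(1) by (metis injD n_not_Suc_n strict_mono_eq)
    ultimately show ?thesis by simp
  qed
  then show False using wfp_realD[OF T, of "\<lambda>n. c - s (r n)"] sT by simp
qed

instantiation hahn :: "{zero, one, plus, minus, uminus, times}"
begin

definition zero_hahn :: hahn where
  "0 = Hahn (\<lambda>_. 0)"

definition one_hahn :: hahn where
  "1 = Hahn (\<lambda>a. if a = 0 then 1 else 0)"

definition plus_hahn :: "hahn \<Rightarrow> hahn \<Rightarrow> hahn" where
  "f + g = Hahn (\<lambda>a. hahn_coeff f a + hahn_coeff g a)"

definition minus_hahn :: "hahn \<Rightarrow> hahn \<Rightarrow> hahn" where
  "f - g = Hahn (\<lambda>a. hahn_coeff f a - hahn_coeff g a)"

definition uminus_hahn :: "hahn \<Rightarrow> hahn" where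
  "- f = Hahn (\<lambda>a. - hahn_coeff f a)"

text \<open>The index set of the sum is finite by lemma \<open>finite_conv\<close>.\<close>

definition times_hahn :: "hahn \<Rightarrow> hahn \<Rightarrow> hahn" where
  "f * g = Hahn (\<lambda>c. \<Sum>a | hahn_coeff f a \<noteq> 0 \<and> hahn_coeff g (c - a) \<noteq> 0. hahn_coeff f a * hahn_coeff g (c - a))"

instance ..

end

lemma hahn_coeff_0 [simp]: "hahn_coeff 0 a = 0"
  by (simp add: zero_hahn_def hahn_coeff_Hahn wfp_on_iff_ex_minimal)

lemma hahn_coeff_1 [simp]: "hahn_coeff 1 a = (if a = 0 then 1 else 0)"
proof -
  have "wfp_on {a::real. (if a = 0 then 1 else 0 :: complex) \<noteq> 0} (<)"
    unfolding wfp_on_iff_ex_minimal by (auto split: if_splits)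
  then show ?thesis by (simp add: one_hahn_def hahn_coeff_Hahn)
qed

lemma hahn_coeff_add [simp]: "hahn_coeff (f + g) a = hahn_coeff f a + hahn_coeff g a"
proof -
  have "wfp_on {a. hahn_coeff f a + hahn_coeff g a \<noteq> 0} (<)"
    by (rule wfp_on_subset[OF wfp_Un[OF wfp_hahn_coeff[of f] wfp_hahn_coeff[of g]]]) auto
  then show ?thesis by (simp add: plus_hahn_def hahn_coeff_Hahn)
qed

lemma hahn_coeff_diff [simp]: "hahn_coeff (f - g) a = hahn_coeff f a - hahn_coeff g a"
proof -
  have "wfp_on {a. hahn_coeff f a - hahn_coeff g a \<noteq> 0} (<)"
    by (rule wfp_on_subset[OF wfp_Un[OF wfp_hahn_coeff[of f] wfp_hahn_coeff[of g]]]) auto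
  then show ?thesis by (simp add: minus_hahn_def hahn_coeff_Hahn)
qed

lemma hahn_coeff_uminus [simp]: "hahn_coeff (- f) a = - hahn_coeff f a"
proof -
  have "wfp_on {a. - hahn_coeff f a \<noteq> 0} (<)" using wfp_hahn_coeff[of f] by simp
  then show ?thesis by (simp add: uminus_hahn_def hahn_coeff_Hahn)
qed

lemma hahn_coeff_mult:
  "hahn_coeff (f * g) c = (\<Sum>a | hahn_coeff f a \<noteq> 0 \<and> hahn_coeff g (c - a) \<noteq> 0. hahn_coeff f a * hahn_coeff g (c - a))"
proof -
  let ?h = "\<lambda>c. \<Sum>a | hahn_coeff f a \<noteq> 0 \<and> hahn_coeff g (c - a) \<noteq> 0. hahn_coeff f a * hahn_coeff g (c - a)"
  have "{c. ?h c \<noteq> 0} \<subseteq> sumset {a. hahn_coeff f a \<noteq> 0} {a. hahn_coeff g a \<noteq> 0}"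
  proof
    fix c assume "c \<in> {c. ?h c \<noteq> 0}"
    then have "{a. hahn_coeff f a \<noteq> 0 \<and> hahn_coeff g (c - a) \<noteq> 0} \<noteq> {}" by (metis (lifting) mem_Collect_eq sum.empty)
    then obtain a where "hahn_coeff f a \<noteq> 0" "hahn_coeff g (c - a) \<noteq> 0" by blast
    then show "c \<in> sumset {a. hahn_coeff f a \<noteq> 0} {a. hahn_coeff g a \<noteq> 0}"
      by (intro sumsetI[of a _ "c - a"]) auto
  qed
  then have "wfp_on {c. ?h c \<noteq> 0} (<)"
    by (rule wfp_on_subset[OF wfp_sumset[OF wfp_hahn_coeff wfp_hahn_coeff]])
  then show ?thesis by (simp add: times_hahn_def hahn_coeff_Hahn)
qed

lemma finite_hahn_coeff_mult: "finite {a. hahn_coeff f a \<noteq> 0 \<and> hahn_coeff g (c - a) \<noteq> 0}"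
  using finite_conv[OF wfp_hahn_coeff[of f] wfp_hahn_coeff[of g], of c] by simp

lemma hahn_coeff_mult_superset:
  assumes "finite F" "\<And>a. hahn_coeff f a \<noteq> 0 \<Longrightarrow> hahn_coeff g (c - a) \<noteq> 0 \<Longrightarrow> a \<in> F"
  shows "hahn_coeff (f * g) c = (\<Sum>a\<in>F. hahn_coeff f a * hahn_coeff g (c - a))"
  unfolding hahn_coeff_mult using assms by (intro sum.mono_neutral_left) auto

lemma hahn_coeff_mult_nz:
  "hahn_coeff (f * g) c \<noteq> 0 \<Longrightarrow> \<exists>a. hahn_coeff f a \<noteq> 0 \<and> hahn_coeff g (c - a) \<noteq> 0"
  unfolding hahn_coeff_mult by (metis (mono_tags, lifting) mem_Collect_eq sum.not_neutral_contains_not_neutral)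

lemma hahn_mult_commute: "f * g = g * (f :: hahn)"
proof (rule hahn_eqI)
  fix c
  show "hahn_coeff (f * g) c = hahn_coeff (g * f) c"
    unfolding hahn_coeff_mult
    by (rule sum.reindex_bij_witness[of _ "\<lambda>a. c - a" "\<lambda>a. c - a"]) auto
qed

lemma hahn_mult_assoc: "(f * g) * h = f * (g * (h :: hahn))"
proof (rule hahn_eqI)
  fix e
  define S T U where "S = {a. hahn_coeff f a \<noteq> 0}" and "T = {a. hahn_coeff g a \<noteq> 0}"
    and "U = {a. hahn_coeff h a \<noteq> 0}"
  define P where "P = {a \<in> S. e - a \<in> sumset T U}"
  define Q where "Q = {s \<in> sumset S T. e - s \<in> U}"
  have w: "wfp_on S (<)" "wfp_on T (<)" "wfp_on U (<)"
    unfolding S_def T_def U_def by (rule wfp_hahn_coeff)+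
  have P: "finite P" unfolding P_def by (intro finite_conv wfp_sumset w)
  have Q: "finite Q" unfolding Q_def by (intro finite_conv wfp_sumset w)
  have fg: "hahn_coeff (f * g) s = (\<Sum>a\<in>P. hahn_coeff f a * hahn_coeff g (s - a))" if "s \<in> Q" for s
  proof (rule hahn_coeff_mult_superset[OF P])
    fix a assume a: "hahn_coeff f a \<noteq> 0" "hahn_coeff g (s - a) \<noteq> 0"
    have "e - a \<in> sumset T U"
      by (rule sumsetI[of "s - a" _ "e - s"]) (use a that in \<open>auto simp: Q_def T_def U_def\<close>)
    then show "a \<in> P" using a by (simp add: P_def S_def)
  qed
  have gh: "hahn_coeff (g * h) (e - a) = (\<Sum>s\<in>Q. hahn_coeff g (s - a) * hahn_coeff h (e - s))" if "a \<in> P" for a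
  proof -
    have "hahn_coeff (g * h) (e - a) = (\<Sum>b\<in>(\<lambda>s. s - a) ` Q. hahn_coeff g b * hahn_coeff h ((e - a) - b))"
    proof (rule hahn_coeff_mult_superset)
      fix b assume b: "hahn_coeff g b \<noteq> 0" "hahn_coeff h (e - a - b) \<noteq> 0"
      have "a + b \<in> sumset S T"
        by (rule sumsetI[of a _ b]) (use b that in \<open>auto simp: P_def T_def\<close>)
      then have "a + b \<in> Q" using b by (simp add: Q_def U_def algebra_simps)
      then show "b \<in> (\<lambda>s. s - a) ` Q" by (rule rev_image_eqI) simp
    qed (simp add: Q)
    also have "\<dots> = (\<Sum>s\<in>Q. hahn_coeff g (s - a) * hahn_coeff h (e - s))"
      by (subst sum.reindex) (auto simp: inj_on_def)
    finally show ?thesis .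
  qed
  have "hahn_coeff ((f * g) * h) e = (\<Sum>s\<in>Q. hahn_coeff (f * g) s * hahn_coeff h (e - s))"
  proof (rule hahn_coeff_mult_superset[OF Q])
    fix s assume s: "hahn_coeff (f * g) s \<noteq> 0" "hahn_coeff h (e - s) \<noteq> 0"
    obtain a where "hahn_coeff f a \<noteq> 0" "hahn_coeff g (s - a) \<noteq> 0"
      using hahn_coeff_mult_nz[OF s(1)] by (elim exE conjE)
    then have "s \<in> sumset S T"
      by (intro sumsetI[of a _ "s - a"]) (auto simp: S_def T_def)
    then show "s \<in> Q" using s(2) by (simp add: Q_def U_def)
  qed
  also have "\<dots> = (\<Sum>s\<in>Q. \<Sum>a\<in>P. hahn_coeff f a * hahn_coeff g (s - a) * hahn_coeff h (e - s))"
    by (simp add: fg sum_distrib_right)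
  also have "\<dots> = (\<Sum>a\<in>P. \<Sum>s\<in>Q. hahn_coeff f a * hahn_coeff g (s - a) * hahn_coeff h (e - s))"
    by (rule sum.swap)
  also have "\<dots> = (\<Sum>a\<in>P. hahn_coeff f a * hahn_coeff (g * h) (e - a))"
    by (simp add: gh sum_distrib_left mult.assoc)
  also have "\<dots> = hahn_coeff (f * (g * h)) e"
  proof (rule hahn_coeff_mult_superset[OF P, symmetric])
    fix a assume a: "hahn_coeff f a \<noteq> 0" "hahn_coeff (g * h) (e - a) \<noteq> 0"
    obtain b where "hahn_coeff g b \<noteq> 0" "hahn_coeff h (e - a - b) \<noteq> 0"
      using hahn_coeff_mult_nz[OF a(2)] by (elim exE conjE)
    then have "e - a \<in> sumset T U"
      by (intro sumsetI[of b _ "e - a - b"]) (auto simp: T_def U_def)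
    then show "a \<in> P" using a(1) by (simp add: P_def S_def)
  qed
  finally show "hahn_coeff ((f * g) * h) e = hahn_coeff (f * (g * h)) e" .
qed

lemma hahn_distrib_right: "(f + g) * h = f * h + g * (h :: hahn)"
proof (rule hahn_eqI)
  fix c
  let ?F = "{a. hahn_coeff f a \<noteq> 0 \<and> hahn_coeff h (c - a) \<noteq> 0} \<union> {a. hahn_coeff g a \<noteq> 0 \<and> hahn_coeff h (c - a) \<noteq> 0}"
  have F: "finite ?F" by (simp add: finite_hahn_coeff_mult)
  have "hahn_coeff ((f + g) * h) c = (\<Sum>a\<in>?F. hahn_coeff (f + g) a * hahn_coeff h (c - a))"
    by (rule hahn_coeff_mult_superset[OF F]) auto
  moreover have "hahn_coeff (f * h) c = (\<Sum>a\<in>?F. hahn_coeff f a * hahn_coeff h (c - a))"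
    by (rule hahn_coeff_mult_superset[OF F]) auto
  moreover have "hahn_coeff (g * h) c = (\<Sum>a\<in>?F. hahn_coeff g a * hahn_coeff h (c - a))"
    by (rule hahn_coeff_mult_superset[OF F]) auto
  ultimately show "hahn_coeff ((f + g) * h) c = hahn_coeff (f * h + g * h) c"
    by (simp only: hahn_coeff_add distrib_right sum.distrib)
qed

instance hahn :: comm_ring_1
proof
  fix f g h :: hahn
  show "f + g + h = f + (g + h)" "f + g = g + f" "0 + f = f" "- f + f = 0" "f - g = f + - g"
    by (rule hahn_eqI; simp)+
  show "f * g * h = f * (g * h)" by (rule hahn_mult_assoc)
  show "f * g = g * f" by (rule hahn_mult_commute)
  show "(f + g) * h = f * h + g * h" by (rule hahn_distrib_right)
  show "1 * f = f"
  proof (rule hahn_eqI)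
    fix c
    have "hahn_coeff (1 * f) c = (\<Sum>a\<in>{0}. hahn_coeff 1 a * hahn_coeff f (c - a))"
      by (rule hahn_coeff_mult_superset) (auto split: if_splits)
    then show "hahn_coeff (1 * f) c = hahn_coeff f c" by simp
  qed
  show "(0 :: hahn) \<noteq> 1"
    by (metis hahn_coeff_0 hahn_coeff_1 zero_neq_one)
qed

lemma hahn_geometric_inverse:
  assumes e: "\<And>a. a \<le> 0 \<Longrightarrow> hahn_coeff e a = 0"
  shows "\<exists>g. (1 - e) * g = 1"
proof (cases "e = 0")
  case True
  then show ?thesis by (intro exI[of _ 1]) simp
next
  case False
  let ?E = "{a. hahn_coeff e a \<noteq> 0}"
  have "?E \<noteq> {}" using False hahn_eqI[of e 0] by auto
  then obtain s where "s \<in> ?E" and smin: "\<And>y. y < s \<Longrightarrow> y \<notin> ?E"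
    using wfp_hahn_coeff[of e] unfolding wfp_on_iff_ex_minimal by (meson order_refl)
  then have s: "s > 0" using e[of s] by force
  have pow: "hahn_coeff (e ^ n) x = 0" if "x < real n * s" for n x
    using that
  proof (induction n arbitrary: x)
    case 0
    then show ?case by simp
  next
    case (Suc n)
    show ?case
    proof (rule ccontr)
      assume "hahn_coeff (e ^ Suc n) x \<noteq> 0"
      then obtain a where a: "hahn_coeff e a \<noteq> 0" "hahn_coeff (e ^ n) (x - a) \<noteq> 0"
        using hahn_coeff_mult_nz[of e "e ^ n" x] by auto
      have "a \<ge> s" using smin[of a] a(1) by force
      moreover have "x - a \<ge> real n * s" using Suc.IH[of "x - a"] a(2) by force
      ultimately show False using Suc.prems by (simp add: algebra_simps)
    qed
  qed
  define G where "G N = (\<Sum>n<N. e ^ n)" for N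
  define N where "N x = Suc (nat \<lceil>x / s\<rceil>)" for x
  have N: "x < real n * s" if "N x \<le> n" for x n
  proof -
    have "x / s \<le> real (nat \<lceil>x / s\<rceil>)" by linarith
    also have "\<dots> < real n" using that unfolding N_def by simp
    finally show ?thesis using s by (simp add: field_simps)
  qed
  have G: "hahn_coeff (G m) x = hahn_coeff (G k) x" if "N x \<le> k" "k \<le> m" for m k x
    using that(2)
  proof (induction m rule: dec_induct)
    case (step m)
    have "hahn_coeff (e ^ m) x = 0" by (rule pow, rule N) (use step that in simp)
    then show ?case using step.IH by (simp add: G_def)
  qed simp
  have mono: "N x \<le> N y" if "x \<le> y" for x y
  proof -
    have "x / s \<le> y / s" using that s by (simp add: divide_right_mono)
    then have "nat \<lceil>x / s\<rceil> \<le> nat \<lceil>y / s\<rceil>" by (intro nat_mono ceiling_mono)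
    then show ?thesis by (simp only: N_def Suc_le_mono)
  qed
  define g where "g x = hahn_coeff (G (N x)) x" for x
  have "wfp_on {x. g x \<noteq> 0} (<)"
    unfolding wfp_real_iff
  proof
    assume "\<exists>u. (\<forall>n::nat. u n \<in> {x. g x \<noteq> 0}) \<and> (\<forall>n. u (Suc n) < u n)"
    then obtain u where u': "\<forall>n::nat. u n \<in> {x. g x \<noteq> 0}" "\<forall>n. u (Suc n) < u n"
      by (elim exE conjE)
    have u: "g (u n) \<noteq> 0" "u (Suc n) < u n" for n using u' by simp_all
    have "u n \<le> u 0" for n
    proof (induction n)
      case (Suc n)
      then show ?case using u(2)[of n] by linarith
    qed simp
    then have "hahn_coeff (G (N (u 0))) (u n) \<noteq> 0" for n
      using u(1)[of n] G[of "u n" "N (u n)" "N (u 0)"] mono unfolding g_def by simp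
    then show False
      using wfp_realD[OF wfp_hahn_coeff[of "G (N (u 0))"], of u] u(2) by simp
  qed
  then have cg: "hahn_coeff (Hahn g) = g" by (rule hahn_coeff_Hahn)
  have "(1 - e) * Hahn g = 1"
  proof (rule hahn_eqI)
    fix x
    let ?d = "1 - e" and ?M = "N x"
    have supp: "a \<ge> 0" if "hahn_coeff ?d a \<noteq> 0" for a
      using that e[of a] by (cases "a < 0") auto
    have eq: "hahn_coeff (Hahn g) (x - a) = hahn_coeff (G ?M) (x - a)" if "hahn_coeff ?d a \<noteq> 0" for a
      using supp[OF that] G[of "x - a" "N (x - a)" ?M] mono[of "x - a" x]
      unfolding cg g_def by simp
    have "hahn_coeff (?d * Hahn g) x = hahn_coeff (?d * G ?M) x"
      unfolding hahn_coeff_mult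
      by (rule sum.cong) (simp_all add: eq cong: conj_cong del: hahn_coeff_diff)
    also have "?d * G ?M = 1 - e ^ ?M"
      unfolding G_def by (rule one_diff_power_eq[symmetric])
    also have "hahn_coeff (1 - e ^ ?M) x = hahn_coeff 1 x"
      using pow[OF N[of x ?M]] by simp
    finally show "hahn_coeff (?d * Hahn g) x = hahn_coeff 1 x" .
  qed
  then show ?thesis by blast
qed

lemma hahn_inverse_exists:
  assumes "f \<noteq> (0 :: hahn)"
  shows "\<exists>g. f * g = 1"
proof -
  let ?F = "{a. hahn_coeff f a \<noteq> 0}"
  have "?F \<noteq> {}" using assms hahn_eqI[of f 0] by auto
  then obtain s where s: "s \<in> ?F" and smin: "\<And>y. y < s \<Longrightarrow> y \<notin> ?F"
    using wfp_hahn_coeff[of f] unfolding wfp_on_iff_ex_minimal by (meson order_refl)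
  define m where "m = Hahn (\<lambda>a. if a = - s then inverse (hahn_coeff f s) else 0)"
  have "wfp_on {a. (if a = - s then inverse (hahn_coeff f s) else 0) \<noteq> 0} (<)"
    by (rule wfp_on_subset[of "{- s}"]) (auto simp: wfp_on_iff_ex_minimal split: if_splits)
  then have cm: "hahn_coeff m a = (if a = - s then inverse (hahn_coeff f s) else 0)" for a
    unfolding m_def by (simp add: hahn_coeff_Hahn)
  have cmf: "hahn_coeff (m * f) c = inverse (hahn_coeff f s) * hahn_coeff f (c + s)" for c
  proof -
    have "hahn_coeff (m * f) c = (\<Sum>a\<in>{- s}. hahn_coeff m a * hahn_coeff f (c - a))"
      by (rule hahn_coeff_mult_superset) (auto simp: cm split: if_splits)
    then show ?thesis by (simp add: cm)
  qed
  have "\<exists>g. (1 - (1 - m * f)) * g = 1"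
  proof (rule hahn_geometric_inverse)
    fix a :: real assume "a \<le> 0"
    then show "hahn_coeff (1 - m * f) a = 0"
      using s smin[of "a + s"] by (cases "a = 0") (auto simp: cmf)
  qed
  then obtain g where "m * f * g = 1" by auto
  then have "f * (m * g) = 1" by (metis mult.assoc mult.commute)
  then show ?thesis by blast
qed

instantiation hahn :: inverse
begin

definition inverse_hahn :: "hahn \<Rightarrow> hahn" where
  "inverse (f :: hahn) = (if f = 0 then 0 else (THE g. f * g = 1))"

definition divide_hahn :: "hahn \<Rightarrow> hahn \<Rightarrow> hahn" where
  "f div (g :: hahn) = f * inverse g"

instance ..

end

instance hahn :: field
proof
  fix f g :: hahn
  show "inverse (0 :: hahn) = 0" by (simp add: inverse_hahn_def)
  show "f div g = f * inverse g" by (rule divide_hahn_def)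
  show "inverse f * f = 1" if nz: "f \<noteq> 0"
  proof -
    obtain g where g: "f * g = 1" using hahn_inverse_exists[OF nz] by blast
    have "(THE g. f * g = 1) = g"
    proof (rule the_equality[where P = "\<lambda>g. f * g = 1", OF g])
      fix h assume "f * h = 1"
      then show "h = g" using g by (metis mult.assoc mult.commute mult.right_neutral)
    qed
    then show ?thesis using g nz by (simp add: inverse_hahn_def mult.commute)
  qed
qed

text \<open>Only meaningful for \<open>f \<noteq> 0\<close>; the minimum then exists because the support is well-ordered.\<close>

definition hahn_deg :: "hahn \<Rightarrow> real" where
  "hahn_deg f = (LEAST a. hahn_coeff f a \<noteq> 0)"

lemma hahn_deg:
  assumes "f \<noteq> 0"
  shows "hahn_coeff f (hahn_deg f) \<noteq> 0" and "hahn_coeff f a \<noteq> 0 \<Longrightarrow> hahn_deg f \<le> a"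
proof -
  have "{a. hahn_coeff f a \<noteq> 0} \<noteq> {}" using assms hahn_eqI[of f 0] by auto
  then obtain s where "hahn_coeff f s \<noteq> 0" "\<And>y. y < s \<Longrightarrow> hahn_coeff f y = 0"
    using wfp_hahn_coeff[of f] unfolding wfp_on_iff_ex_minimal
    by (metis (mono_tags, lifting) mem_Collect_eq order_refl)
  then have "hahn_deg f = s \<and> hahn_coeff f s \<noteq> 0 \<and> (\<forall>y. hahn_coeff f y \<noteq> 0 \<longrightarrow> s \<le> y)"
    unfolding hahn_deg_def by (metis (mono_tags, lifting) Least_equality leI)
  then show "hahn_coeff f (hahn_deg f) \<noteq> 0" "hahn_coeff f a \<noteq> 0 \<Longrightarrow> hahn_deg f \<le> a" by auto
qed

section \<open>Barvinok rank\<close>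

definition tropical_mult :: "real mat \<Rightarrow> real mat \<Rightarrow> real mat" where
  "tropical_mult A B = mat (dim_row A) (dim_col B)
     (\<lambda>(i, j). Min ((\<lambda>k. A $$ (i, k) + B $$ (k, j)) ` {..<dim_col A}))"

text \<open>The tropical sum of \<open>N 0, \<dots>, N (r - 1)\<close>, all of size \<open>d \<times> n\<close>. Over the reals, without an
  infinite element, there is no empty tropical sum, so \<open>r \<ge> 1\<close> is needed.\<close>

definition tropical_sum :: "nat \<Rightarrow> nat \<Rightarrow> nat \<Rightarrow> (nat \<Rightarrow> real mat) \<Rightarrow> real mat" where
  "tropical_sum d n r N = mat d n (\<lambda>(i, j). Min ((\<lambda>k. N k $$ (i, j)) ` {..<r}))"

definition barvinok_rank :: "real mat \<Rightarrow> nat" where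
  "barvinok_rank M = (LEAST r. r \<ge> 1 \<and>
     (\<exists>X Y. (\<forall>k<r. X k \<in> carrier_mat (dim_row M) 1 \<and> Y k \<in> carrier_mat 1 (dim_col M)) \<and>
        M = tropical_sum (dim_row M) (dim_col M) r (\<lambda>k. tropical_mult (X k) (Y k))))"

section \<open>Tropical rank\<close>

definition permutation_weight :: "real mat \<Rightarrow> (nat \<Rightarrow> nat) \<Rightarrow> real" where
  "permutation_weight A \<sigma> = (\<Sum>i<dim_row A. A $$ (i, \<sigma> i))"

definition tropically_singular :: "real mat \<Rightarrow> bool" where
  "tropically_singular A \<longleftrightarrow>
     (\<exists>\<sigma> \<tau>. \<sigma> permutes {..<dim_row A} \<and> \<tau> permutes {..<dim_row A} \<and> \<sigma> \<noteq> \<tau> \<and>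
        permutation_weight A \<sigma> = Min (permutation_weight A ` {\<pi>. \<pi> permutes {..<dim_row A}}) \<and>
        permutation_weight A \<tau> = Min (permutation_weight A ` {\<pi>. \<pi> permutes {..<dim_row A}}))"

definition tropical_rank :: "real mat \<Rightarrow> nat" where
  "tropical_rank M = (GREATEST r. \<exists>I J. I \<subseteq> {..<dim_row M} \<and> J \<subseteq> {..<dim_col M} \<and>
     card I = r \<and> card J = r \<and> \<not> tropically_singular (submatrix M I J))"

section \<open>Kapranov rank\<close>

definition tropicalization :: "hahn vec set \<Rightarrow> real vec set" where
  "tropicalization V = {map_vec hahn_deg f |f. f \<in> V \<and> (\<forall>i<dim_vec f. f $ i \<noteq> 0)}"

text \<open>\<open>L\<close> is a tropical linear space of dimension \<open>k\<close> in real \<open>d\<close>-space.\<close>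

definition tropical_linear_space :: "nat \<Rightarrow> nat \<Rightarrow> real vec set \<Rightarrow> bool" where
  "tropical_linear_space d k L \<longleftrightarrow>
     (\<exists>V. VectorSpace.subspace class_ring V (module_vec TYPE(hahn) d) \<and>
        vectorspace.dim class_ring ((module_vec TYPE(hahn) d)\<lparr>carrier := V\<rparr>) = k \<and>
        L = tropicalization V)"

definition kapranov_rank :: "real mat \<Rightarrow> nat" where
  "kapranov_rank M = (LEAST k. \<exists>L. tropical_linear_space (dim_row M) k L \<and> set (cols M) \<subseteq> L)"

end

theory Submission
  imports Defs
begin

text \<open>
  A matrix \<open>F\<close> over the field of power series that factors through inner dimension \<open>k\<close> has its
  columns in the span of \<open>k\<close> vectors. Hence the Kapranov rank of \<open>M\<close> is at most \<open>k\<close> exactly if \<open>M\<close> is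
  the entrywise degree of some product \<open>F = P L\<close> of inner dimension \<open>k\<close> without zero entries
  (\<open>lifts_through_if_linear_space\<close>, \<open>linear_space_if_lifts_through\<close>). Everything else is about such
  lifts.

  For the lower bound, suppose that an \<open>r \<times> r\<close> submatrix of \<open>M\<close> is tropically non-singular. Then one term
  in the Leibniz expansion of the corresponding minor of \<open>F\<close> has strictly smaller degree than all others
  and cannot cancel, so the minor is nonzero and \<open>r \<le> k\<close>. The argument uses nothing about power series
  except that the degree is a valuation, and \<open>tropical_rank_le\<close> is proved for any valuation on an
  integral domain.

  For the upper bound, write \<open>M\<close> as a minimum of \<open>r\<close> matrices with entries \<open>x\<^sub>i + y\<^sub>j\<close>
  and replace these entries by \<open>t\<close> to the \<open>x\<^sub>i\<close> times \<open>t\<close> to the \<open>y\<^sub>j\<close>, and the minimum by the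
  sum. All coefficients of the sum are nonnegative integers, so nothing cancels and the degree of the
  sum is the minimum (\<open>lifts_through_if_min_of_rank1\<close>).

  The \<open>3 \<times> 3\<close> identity matrix separates Kapranov and Barvinok rank. It lifts to a matrix whose columns
  have coordinate sum \<open>0\<close>, hence has Kapranov rank at most \<open>2\<close>. But a rank-one matrix that
  lies above it and attains two of its zeros at \<open>(0,1)\<close>, \<open>(1,2)\<close>, \<open>(2,0)\<close> would be negative
  somewhere or too small on the diagonal, so each of these zeros needs its own rank-one matrix.

  The point-line incidence matrix of the Fano plane separates tropical and Kapranov rank. The Fano plane
  lives over the field with two elements. Accordingly its incidence matrix is the entrywise \<open>2\<close>-adic
  valuation of an integer matrix of rank \<open>3\<close>, and the bound for general valuations gives tropical rank at
  most \<open>3\<close>. On the other hand, from a lift of rank at most \<open>3\<close> to complex power series the constant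
  coefficients form a complex matrix of rank at most \<open>3\<close> whose zeros are exactly the incidences. This
  is a realization of the Fano plane over the complex numbers, where \<open>2 \<noteq> 0\<close> makes it impossible
  (\<open>fano_not_realizable\<close>).
\<close>

section \<open>Valuations and tropically non-singular matrices\<close>

text \<open>The value at \<open>0\<close>, usually infinity, is left open so that \<open>v\<close> can be real-valued.\<close>

locale valuation =
  fixes v :: "'a::idom \<Rightarrow> real"
  assumes val_mult: "x \<noteq> 0 \<Longrightarrow> y \<noteq> 0 \<Longrightarrow> v (x * y) = v x + v y"
    and val_add: "x \<noteq> 0 \<Longrightarrow> y \<noteq> 0 \<Longrightarrow> x + y \<noteq> 0 \<Longrightarrow> min (v x) (v y) \<le> v (x + y)"
begin

lemma val_1: "v 1 = 0"
  using val_mult[of 1 1] by simp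

lemma val_neg_1: "v (-1) = 0"
  using val_mult[of "-1" "-1"] val_1 by simp

lemma val_uminus: "x \<noteq> 0 \<Longrightarrow> v (- x) = v x"
  using val_mult[of "-1" x] val_neg_1 by simp

lemma val_prod:
  assumes "finite I" "\<And>i. i \<in> I \<Longrightarrow> f i \<noteq> 0"
  shows "v (\<Prod>i\<in>I. f i) = (\<Sum>i\<in>I. v (f i))"
  using assms by (induction I rule: finite_induct) (simp_all add: val_1 val_mult)

lemma val_sum_greater:
  assumes "finite S" "\<And>x. x \<in> S \<Longrightarrow> f x \<noteq> 0 \<Longrightarrow> w < v (f x)" "(\<Sum>x\<in>S. f x) \<noteq> 0"
  shows "w < v (\<Sum>x\<in>S. f x)"
  using assms
proof (induction S rule: finite_induct)
  case (insert x S)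
  consider "f x = 0" | "sum f S = 0" | "f x \<noteq> 0" "sum f S \<noteq> 0" by blast
  then show ?case
  proof cases
    case 3
    have "w < v (f x)" "w < v (sum f S)" using insert 3 by auto
    moreover have "min (v (f x)) (v (sum f S)) \<le> v (f x + sum f S)"
      using val_add[of "f x" "sum f S"] 3 insert.hyps insert.prems by simp
    ultimately show ?thesis using insert.hyps by simp
  qed (use insert in simp_all)
qed simp

text \<open>A summand of strictly least valuation cannot be cancelled: the other summands add up to something of
  larger valuation, whereas cancelling would need the same valuation.\<close>

lemma sum_nonzero_if_unique_least:
  assumes S: "finite S" "x \<in> S" and fx: "f x \<noteq> 0"
    and less: "\<And>y. y \<in> S \<Longrightarrow> y \<noteq> x \<Longrightarrow> f y \<noteq> 0 \<Longrightarrow> v (f x) < v (f y)"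
  shows "(\<Sum>y\<in>S. f y) \<noteq> 0"
proof
  assume "(\<Sum>y\<in>S. f y) = 0"
  then have eq: "(\<Sum>y\<in>S - {x}. f y) = - f x"
    using S by (simp add: sum.remove[of S x] eq_neg_iff_add_eq_0 add.commute)
  then have "v (f x) < v (\<Sum>y\<in>S - {x}. f y)"
    using S fx less by (intro val_sum_greater) auto
  then show False using eq val_uminus[OF fx] by simp
qed

text \<open>The valuation of the Leibniz term of a permutation is the weight of that permutation, so
  non-singularity provides a term of strictly least valuation.\<close>

lemma det_nonzero_if_nonsingular:
  assumes G: "G \<in> carrier_mat r r" and A: "A \<in> carrier_mat r r"
    and lift: "\<And>i j. i < r \<Longrightarrow> j < r \<Longrightarrow> G $$ (i, j) \<noteq> 0 \<and> v (G $$ (i, j)) = A $$ (i, j)"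
    and ns: "\<not> tropically_singular A"
  shows "det G \<noteq> 0"
proof -
  let ?S = "{\<pi>. \<pi> permutes {0..<r}}"
  let ?w = "permutation_weight A"
  let ?t = "\<lambda>\<pi>. signof \<pi> * (\<Prod>i = 0..<r. G $$ (i, \<pi> i))"
  have dim: "dim_row A = r" using A by simp
  have S: "finite ?S" "?S \<noteq> {}" using permutes_id[of "{0..<r}"] by (blast intro: finite_permutations)+
  have Min_in: "Min (?w ` ?S) \<in> ?w ` ?S" using S by (intro Min_in) auto
  then obtain \<sigma> where \<sigma>: "\<sigma> \<in> ?S" "?w \<sigma> = Min (?w ` ?S)" by auto
  have less: "?w \<sigma> < ?w \<pi>" if "\<pi> \<in> ?S" "\<pi> \<noteq> \<sigma>" for \<pi>
  proof -
    have "?w \<sigma> \<le> ?w \<pi>" using S that \<sigma> by simp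
    moreover have "?w \<pi> \<noteq> ?w \<sigma>"
    proof
      assume "?w \<pi> = ?w \<sigma>"
      then have "tropically_singular A"
        using that \<sigma> unfolding tropically_singular_def dim atLeast0LessThan
        by (intro exI[of _ \<sigma>] exI[of _ \<pi>] conjI) simp_all
      then show False using ns by blast
    qed
    ultimately show ?thesis by simp
  qed
  have t: "?t \<pi> \<noteq> 0 \<and> v (?t \<pi>) = ?w \<pi>" if "\<pi> \<in> ?S" for \<pi>
  proof -
    have \<pi>: "\<pi> i < r" if "i < r" for i using \<open>\<pi> \<in> ?S\<close> that permutes_in_image[of \<pi> "{0..<r}" i] by simp
    let ?p = "\<Prod>i = 0..<r. G $$ (i, \<pi> i)"
    have nz: "?p \<noteq> 0" using lift \<pi> by simp
    have "v ?p = (\<Sum>i = 0..<r. v (G $$ (i, \<pi> i)))" using lift \<pi> by (intro val_prod) auto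
    also have "\<dots> = ?w \<pi>"
      unfolding permutation_weight_def using lift \<pi> A by (auto simp: atLeast0LessThan intro!: sum.cong)
    finally show ?thesis using nz val_uminus[OF nz] by (auto simp: sign_def)
  qed
  have "(\<Sum>\<pi>\<in>?S. ?t \<pi>) \<noteq> 0"
    using S \<sigma> t less by (intro sum_nonzero_if_unique_least[where x = \<sigma>]) auto
  then show ?thesis by (simp add: det_def'[OF G])
qed

end

lemma det_zero_col:
  assumes A: "A \<in> carrier_mat r r" and "k < r" and zero: "\<And>i. i < r \<Longrightarrow> A $$ (i, k) = 0"
  shows "det A = 0"
  unfolding det_def'[OF A]
proof (rule sum.neutral, safe)
  fix \<pi> assume \<pi>: "\<pi> permutes {0..<r}"
  define i where "i = inv_into UNIV \<pi> k"
  have "i < r" "\<pi> i = k"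
    using \<open>k < r\<close> permutes_inverses(1)[OF \<pi>] permutes_in_image[OF permutes_inv[OF \<pi>], of k]
    by (simp_all add: i_def)
  then have "(\<Prod>i = 0..<r. A $$ (i, \<pi> i)) = 0"
    using zero[of i] by (intro prod_zero) (auto intro!: bexI[of _ i])
  then show "signof \<pi> * (\<Prod>i = 0..<r. A $$ (i, \<pi> i)) = 0" by simp
qed

text \<open>Padding both factors with zeros to size \<open>r \<times> r\<close> leaves the product unchanged and gives the left factor
  a zero column, so the determinant vanishes over any commutative ring.\<close>

lemma det_product_of_small_inner_dim:
  fixes P :: "nat \<Rightarrow> nat \<Rightarrow> 'a::comm_ring_1"
  assumes "k < r"
  shows "det (mat r r (\<lambda>(a, b). \<Sum>c<k. P a c * L c b)) = 0"
proof -
  let ?P = "mat r r (\<lambda>(a, c). if c < k then P a c else 0)"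
  let ?L = "mat r r (\<lambda>(c, b). if c < k then L c b else 0)"
  have "mat r r (\<lambda>(a, b). \<Sum>c<k. P a c * L c b) = ?P * ?L"
  proof (rule eq_matI)
    fix a b assume "a < dim_row (?P * ?L)" "b < dim_col (?P * ?L)"
    then have "(?P * ?L) $$ (a, b) = (\<Sum>c = 0..<r. if c < k then P a c * L c b else 0)"
      by (auto simp: scalar_prod_def intro!: sum.cong)
    also have "\<dots> = (\<Sum>c<k. P a c * L c b)"
      using assms by (intro sum.mono_neutral_cong_right) auto
    finally show "mat r r (\<lambda>(a, b). \<Sum>c<k. P a c * L c b) $$ (a, b) = (?P * ?L) $$ (a, b)"
      using \<open>a < _\<close> \<open>b < _\<close> by simp
  qed simp_all
  moreover have "det ?P = 0" using assms by (intro det_zero_col[where k = k and r = r]) auto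
  ultimately show ?thesis by (simp add: det_mult[of ?P r])
qed

text \<open>The matrix \<open>M\<close> is the entrywise valuation of a product of inner dimension \<open>k\<close>. The factors are functions
  on indices, so that minors of the product arise by reindexing. Zero entries are excluded because \<open>v 0\<close>
  carries no information.\<close>

definition lifts_through :: "('a::idom \<Rightarrow> real) \<Rightarrow> real mat \<Rightarrow> nat \<Rightarrow> bool" where
  "lifts_through v M k \<longleftrightarrow> (\<exists>P L. \<forall>i<dim_row M. \<forall>j<dim_col M.
     (\<Sum>c<k. P i c * L c j) \<noteq> 0 \<and> v (\<Sum>c<k. P i c * L c j) = M $$ (i, j))"

text \<open>The greatest such size exists because the empty submatrix is non-singular (its only permutation is the
  identity) and no submatrix has more rows than \<open>M\<close>.\<close>

lemma tropical_rank_submatrix: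
  obtains I J where "I \<subseteq> {..<dim_row M}" "J \<subseteq> {..<dim_col M}" "card I = tropical_rank M"
    "card J = tropical_rank M" "\<not> tropically_singular (submatrix M I J)"
proof -
  let ?Q = "\<lambda>r. \<exists>I J. I \<subseteq> {..<dim_row M} \<and> J \<subseteq> {..<dim_col M} \<and> card I = r \<and> card J = r \<and>
    \<not> tropically_singular (submatrix M I J)"
  have "?Q 0"
    by (intro exI[of _ "{}"]) (simp add: tropically_singular_def dim_submatrix)
  moreover have "r \<le> dim_row M" if Q: "?Q r" for r
  proof -
    obtain I where "I \<subseteq> {..<dim_row M}" "card I = r" using Q by blast
    then show ?thesis using card_mono[of "{..<dim_row M}" I] by simp
  qed
  ultimately have "?Q (tropical_rank M)"
    unfolding tropical_rank_def by (rule GreatestI_nat)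
  then show thesis using that by blast
qed

theorem (in valuation) tropical_rank_le:
  assumes "lifts_through v M k"
  shows "tropical_rank M \<le> k"
proof (rule ccontr)
  assume k: "\<not> tropical_rank M \<le> k"
  let ?r = "tropical_rank M"
  obtain I J where IJ: "I \<subseteq> {..<dim_row M}" "J \<subseteq> {..<dim_col M}" "card I = ?r" "card J = ?r"
    and ns: "\<not> tropically_singular (submatrix M I J)"
    by (rule tropical_rank_submatrix)
  obtain P L where PL: "\<And>i j. i < dim_row M \<Longrightarrow> j < dim_col M \<Longrightarrow>
      (\<Sum>c<k. P i c * L c j) \<noteq> 0 \<and> v (\<Sum>c<k. P i c * L c j) = M $$ (i, j)"
    using assms unfolding lifts_through_def by (elim exE) blast
  have sets: "{i. i < dim_row M \<and> i \<in> I} = I" "{j. j < dim_col M \<and> j \<in> J} = J"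
    using IJ by auto
  have A: "submatrix M I J \<in> carrier_mat ?r ?r"
    by (intro carrier_matI) (simp_all only: dim_submatrix sets IJ(3,4))
  let ?G = "mat ?r ?r (\<lambda>(a, b). \<Sum>c<k. P (pick I a) c * L c (pick J b))"
  have "det ?G \<noteq> 0"
  proof (rule det_nonzero_if_nonsingular[OF _ A _ ns])
    fix a b assume ab: "a < ?r" "b < ?r"
    have "pick I a < dim_row M" "pick J b < dim_col M"
      using pick_in_set_le[of a I] pick_in_set_le[of b J] IJ ab by (simp_all add: subset_iff)
    note PL[OF this]
    moreover have "submatrix M I J $$ (a, b) = M $$ (pick I a, pick J b)"
      using submatrix_index[of a M I b J] ab by (simp only: sets IJ(3,4))
    ultimately show "?G $$ (a, b) \<noteq> 0 \<and> v (?G $$ (a, b)) = submatrix M I J $$ (a, b)"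
      using ab by simp
  qed simp
  moreover have "det ?G = 0"
    using k det_product_of_small_inner_dim[of k ?r "\<lambda>a. P (pick I a)" "\<lambda>c b. L c (pick J b)"] by simp
  ultimately show False by simp
qed

section \<open>The degree of a power series as a valuation\<close>

lemma hahn_coeff_below_deg: "f \<noteq> 0 \<Longrightarrow> a < hahn_deg f \<Longrightarrow> hahn_coeff f a = 0"
  using hahn_deg(2)[of f a] by (cases "hahn_coeff f a = 0") auto

lemma hahn_degI:
  assumes "hahn_coeff f a \<noteq> 0" "\<And>b. b < a \<Longrightarrow> hahn_coeff f b = 0"
  shows "f \<noteq> 0 \<and> hahn_deg f = a"
proof
  show "f \<noteq> 0" using assms(1) by auto
  then show "hahn_deg f = a"
    using assms hahn_deg[of f] by (metis leI order_antisym_conv)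
qed

text \<open>At the sum of two lower bounds for the supports, only one pair of exponents can contribute to the
  product. For the degrees as bounds this is multiplicativity of the leading term; for the bounds \<open>0\<close> it says
  that taking the constant coefficient is multiplicative.\<close>

lemma hahn_coeff_mult_low:
  assumes f: "\<And>x. x < a \<Longrightarrow> hahn_coeff f x = 0" and g: "\<And>x. x < b \<Longrightarrow> hahn_coeff g x = 0"
  shows "hahn_coeff (f * g) (a + b) = hahn_coeff f a * hahn_coeff g b"
    and "x < a + b \<Longrightarrow> hahn_coeff (f * g) x = 0"
proof -
  have "y = a" if "hahn_coeff f y \<noteq> 0" "hahn_coeff g (a + b - y) \<noteq> 0" for y
    using that f[of y] g[of "a + b - y"] by linarith
  then have "hahn_coeff (f * g) (a + b) = (\<Sum>y\<in>{a}. hahn_coeff f y * hahn_coeff g (a + b - y))"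
    by (intro hahn_coeff_mult_superset) auto
  then show "hahn_coeff (f * g) (a + b) = hahn_coeff f a * hahn_coeff g b" by simp
  show "hahn_coeff (f * g) x = 0" if "x < a + b"
  proof (rule ccontr)
    assume "hahn_coeff (f * g) x \<noteq> 0"
    then obtain y where "hahn_coeff f y \<noteq> 0" "hahn_coeff g (x - y) \<noteq> 0"
      using hahn_coeff_mult_nz by blast
    then show False using f[of y] g[of "x - y"] that by linarith
  qed
qed

interpretation hahn: valuation hahn_deg
proof
  fix f g :: hahn assume nz: "f \<noteq> 0" "g \<noteq> 0"
  have "f * g \<noteq> 0 \<and> hahn_deg (f * g) = hahn_deg f + hahn_deg g"
    using nz by (intro hahn_degI)
      (simp_all add: hahn_coeff_mult_low(1) hahn_coeff_mult_low(2)[of "hahn_deg f" f "hahn_deg g"]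
        hahn_coeff_below_deg hahn_deg)
  then show "hahn_deg (f * g) = hahn_deg f + hahn_deg g" ..
  show "min (hahn_deg f) (hahn_deg g) \<le> hahn_deg (f + g)" if "f + g \<noteq> 0"
    using hahn_deg(1)[OF that] hahn_deg(2)[OF nz(1), of "hahn_deg (f + g)"]
      hahn_deg(2)[OF nz(2), of "hahn_deg (f + g)"] by fastforce
qed

section \<open>Kapranov rank as least inner dimension of a lift\<close>

text \<open>A subspace is finite-dimensional because independence of a set does not depend on whether it is
  considered in the subspace or in the whole space, so an independent subset of maximal size exists.\<close>

lemma (in vec_space) subspace_generators:
  assumes W: "VectorSpace.subspace class_ring W V"
  obtains B where "finite B" "B \<subseteq> W" "span B = W" "card B = vectorspace.dim class_ring (vs W)"
proof -
  interpret W: vectorspace class_ring "vs W" by (rule subspace_is_vs[OF W])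
  have sub: "submodule class_ring W V" using W by (simp add: VectorSpace.subspace_def)
  have WV: "W \<subseteq> carrier_vec n" using sub by (simp add: submodule_def)
  let ?li = "\<lambda>S. S \<subseteq> carrier (vs W) \<and> W.lin_indpt S"
  have li: "finite S \<and> card S \<le> dim" if "?li S" for S
    using that span_li_not_depend(2)[OF _ sub, of S] WV li_le_dim[of S] by auto
  have "W.lin_indpt {}" by (simp add: W.lin_dep_def)
  then obtain S where S: "finite S" "maximal S ?li"
    using maximal_exists[of ?li, OF li, of "{}"] by auto
  then have "W.basis S" by (intro W.max_li_is_basis)
  then have "W.fin_dim" unfolding W.fin_dim_def W.basis_def using S by blast
  then obtain B where B: "finite B" "W.basis B" using W.finite_basis_exists by blast
  then have BW: "B \<subseteq> W" "W.span B = W" by (simp_all add: W.basis_def)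
  moreover have "span B = W" using span_li_not_depend(1)[OF BW(1) sub] BW(2) by simp
  ultimately show thesis using that B W.dim_basis[OF B] by simp
qed

text \<open>The left factor consists of generators of the linear space, the right factor of the coordinates of the
  lifted columns with respect to them.\<close>

lemma lifts_through_if_linear_space:
  assumes L: "tropical_linear_space (dim_row M) k L" and cols: "set (cols M) \<subseteq> L"
  shows "lifts_through hahn_deg M k"
proof -
  interpret vec_space "TYPE(hahn)" "dim_row M" .
  obtain W where W: "VectorSpace.subspace class_ring W V" "vectorspace.dim class_ring (vs W) = k"
    and L: "L = tropicalization W"
    using L unfolding tropical_linear_space_def by blast
  obtain B where B: "finite B" "B \<subseteq> W" "span B = W" "card B = k"
    using subspace_generators[OF W(1)] W(2) by metis
  have BV: "B \<subseteq> carrier_vec (dim_row M)" using B W(1) by (auto simp: VectorSpace.subspace_def submodule_def)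
  obtain b where b: "bij_betw b {0..<k} B" using ex_bij_betw_nat_finite[OF B(1)] B(4) by auto
  have "\<exists>a. \<forall>i<dim_row M. (\<Sum>x\<in>B. a x * x $ i) \<noteq> 0 \<and> hahn_deg (\<Sum>x\<in>B. a x * x $ i) = M $$ (i, j)"
    if j: "j < dim_col M" for j
  proof -
    have "col M j \<in> L" using cols j by (auto simp: cols_def)
    then obtain f where f: "f \<in> W" "\<forall>i<dim_vec f. f $ i \<noteq> 0" "col M j = map_vec hahn_deg f"
      unfolding L tropicalization_def by blast
    obtain a where a: "f = lincomb a B"
      using f(1) B(3) finite_span[OF B(1) BV] by auto
    have dim: "dim_vec f = dim_row M" using arg_cong[OF f(3), of dim_vec] by simp
    have "f $ i \<noteq> 0 \<and> hahn_deg (f $ i) = M $$ (i, j)" if "i < dim_row M" for i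
      using f(2) dim that j arg_cong[OF f(3), of "\<lambda>x. x $ i"] by simp
    then show ?thesis using lincomb_index[OF _ BV, of _ a] a by (intro exI[of _ a]) simp
  qed
  then obtain a where a: "\<And>i j. i < dim_row M \<Longrightarrow> j < dim_col M \<Longrightarrow>
      (\<Sum>x\<in>B. a j x * x $ i) \<noteq> 0 \<and> hahn_deg (\<Sum>x\<in>B. a j x * x $ i) = M $$ (i, j)"
    by metis
  have "(\<Sum>x\<in>B. a j x * x $ i) = (\<Sum>c<k. b c $ i * a j (b c))" for i j
    using sum.reindex_bij_betw[OF b, of "\<lambda>x. a j x * x $ i"]
    by (simp add: atLeast0LessThan mult.commute)
  then show ?thesis
    unfolding lifts_through_def using a by (intro exI[of _ "\<lambda>i c. b c $ i"] exI[of _ "\<lambda>c j. a j (b c)"]) simp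
qed

text \<open>The columns of the left factor span the linear space. They may be dependent, so its dimension \<open>m\<close> may be
  smaller than \<open>k\<close>.\<close>

lemma linear_space_if_lifts_through:
  assumes "lifts_through hahn_deg M k"
  shows "\<exists>m\<le>k. \<exists>L. tropical_linear_space (dim_row M) m L \<and> set (cols M) \<subseteq> L"
proof -
  interpret vec_space "TYPE(hahn)" "dim_row M" .
  obtain P Q where PQ: "\<And>i j. i < dim_row M \<Longrightarrow> j < dim_col M \<Longrightarrow>
      (\<Sum>c<k. P i c * Q c j) \<noteq> 0 \<and> hahn_deg (\<Sum>c<k. P i c * Q c j) = M $$ (i, j)"
    using assms unfolding lifts_through_def by (elim exE) blast
  let ?ps = "map (\<lambda>c. vec (dim_row M) (\<lambda>i. P i c)) [0..<k]"
  let ?W = "span (set ?ps)"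
  have psV: "set ?ps \<subseteq> carrier_vec (dim_row M)" by auto
  have W: "VectorSpace.subspace class_ring ?W V" using span_is_subspace psV by simp
  interpret W: vectorspace class_ring "vs ?W" by (rule subspace_is_vs[OF W])
  have psW: "set ?ps \<subseteq> ?W" by (rule in_own_span[OF psV])
  have "W.span (set ?ps) = ?W"
    using span_li_not_depend(1)[OF psW] W by (simp add: VectorSpace.subspace_def)
  then have "W.dim \<le> card (set ?ps)" using psW by (intro W.gen_ge_dim) auto
  also have "\<dots> \<le> k" using card_length[of ?ps] by simp
  finally have "W.dim \<le> k" .
  moreover have "set (cols M) \<subseteq> tropicalization ?W"
  proof
    fix x assume "x \<in> set (cols M)"
    then obtain j where j: "j < dim_col M" "x = col M j" by (auto simp: cols_def)
    \<comment> \<open>A combination of the list, not of its set of elements, since columns of \<open>P\<close> may coincide.\<close>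
    let ?f = "lincomb_list (\<lambda>c. Q c j) ?ps"
    have fi: "?f $ i = (\<Sum>c<k. P i c * Q c j)" if "i < dim_row M" for i
      using that by (subst lincomb_list_as_mat_mult)
        (auto simp: scalar_prod_def mat_of_cols_def atLeast0LessThan intro!: sum.cong)
    have dim: "dim_vec ?f = dim_row M" by (subst lincomb_list_as_mat_mult) auto
    have "?f \<in> ?W" unfolding span_list_as_span[OF psV, symmetric] span_list_def by auto
    moreover have "x = map_vec hahn_deg ?f"
      using j dim fi PQ by (intro eq_vecI) auto
    moreover have "\<forall>i<dim_vec ?f. ?f $ i \<noteq> 0" using dim fi PQ j by auto
    ultimately show "x \<in> tropicalization ?W" unfolding tropicalization_def by blast
  qed
  ultimately show ?thesis unfolding tropical_linear_space_def using W by blast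
qed

lemma kapranov_rank_le:
  assumes "lifts_through hahn_deg M k"
  shows "kapranov_rank M \<le> k"
proof -
  obtain m where m: "m \<le> k" "\<exists>L. tropical_linear_space (dim_row M) m L \<and> set (cols M) \<subseteq> L"
    using linear_space_if_lifts_through[OF assms] by (elim exE conjE) blast
  show ?thesis unfolding kapranov_rank_def by (rule order_trans[OF Least_le m(1)]) (rule m(2))
qed

text \<open>The hypothesis, for some \<open>k\<close>, makes the minimum in the definition of the Kapranov rank one over a
  nonempty set.\<close>

lemma lifts_through_kapranov_rank:
  assumes "lifts_through hahn_deg M k"
  shows "lifts_through hahn_deg M (kapranov_rank M)"
proof -
  obtain m where "\<exists>L. tropical_linear_space (dim_row M) m L \<and> set (cols M) \<subseteq> L"
    using linear_space_if_lifts_through[OF assms] by (elim exE conjE) blast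
  then have "\<exists>L. tropical_linear_space (dim_row M) (kapranov_rank M) L \<and> set (cols M) \<subseteq> L"
    unfolding kapranov_rank_def by (rule LeastI)
  then show ?thesis using lifts_through_if_linear_space by blast
qed

section \<open>Comparison with the Barvinok rank\<close>

definition hahn_monom :: "real \<Rightarrow> hahn" where
  "hahn_monom a = Hahn (\<lambda>x. if x = a then 1 else 0)"

lemma hahn_coeff_monom [simp]: "hahn_coeff (hahn_monom a) x = (if x = a then 1 else 0)"
proof -
  have "wfp_on {x. (if x = a then 1 else 0 :: complex) \<noteq> 0} (<)"
    by (rule wfp_on_subset[of "{a}"]) (auto simp: wfp_on_iff_ex_minimal split: if_splits)
  then show ?thesis unfolding hahn_monom_def by (simp add: hahn_coeff_Hahn)
qed

lemma hahn_monom_mult: "hahn_monom a * hahn_monom b = hahn_monom (a + b)"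
proof (rule hahn_eqI)
  fix c
  have "hahn_coeff (hahn_monom a * hahn_monom b) c =
      (\<Sum>x\<in>{a}. hahn_coeff (hahn_monom a) x * hahn_coeff (hahn_monom b) (c - x))"
    by (rule hahn_coeff_mult_superset) (auto split: if_splits)
  then show "hahn_coeff (hahn_monom a * hahn_monom b) c = hahn_coeff (hahn_monom (a + b)) c"
    by (auto simp: algebra_simps)
qed

lemma hahn_coeff_sum: "hahn_coeff (\<Sum>x\<in>S. f x) a = (\<Sum>x\<in>S. hahn_coeff (f x) a)"
  by (induction S rule: infinite_finite_induct) simp_all

text \<open>The coefficients count how often an exponent occurs, hence are nonzero in characteristic \<open>0\<close> wherever an
  exponent occurs at all.\<close>

lemma hahn_deg_sum_monom:
  assumes "finite S" "S \<noteq> {}"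
  shows "(\<Sum>x\<in>S. hahn_monom (e x)) \<noteq> 0 \<and> hahn_deg (\<Sum>x\<in>S. hahn_monom (e x)) = Min (e ` S)"
proof (rule hahn_degI)
  have coeff: "hahn_coeff (\<Sum>x\<in>S. hahn_monom (e x)) a = of_nat (card {x \<in> S. a = e x})" for a
    using assms(1) by (simp add: hahn_coeff_sum sum.If_cases Int_def)
  have "Min (e ` S) \<in> e ` S" using assms by (intro Min_in) auto
  then have "{x \<in> S. Min (e ` S) = e x} \<noteq> {}" by auto
  then show "hahn_coeff (\<Sum>x\<in>S. hahn_monom (e x)) (Min (e ` S)) \<noteq> 0"
    using assms(1) by (simp add: coeff)
  show "hahn_coeff (\<Sum>x\<in>S. hahn_monom (e x)) b = 0" if "b < Min (e ` S)" for b
  proof -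
    have "Min (e ` S) \<le> e x" if "x \<in> S" for x using that assms(1) by (intro Min_le) auto
    then have "{x \<in> S. b = e x} = {}" using that by force
    then show ?thesis unfolding coeff by (simp only: card.empty of_nat_0)
  qed
qed

text \<open>The condition minimized by the Barvinok rank, with the column and row vectors replaced by their
  entries.\<close>

definition is_min_of_rank1 :: "real mat \<Rightarrow> nat \<Rightarrow> bool" where
  "is_min_of_rank1 M r \<longleftrightarrow> r \<ge> 1 \<and> (\<exists>x y. \<forall>i<dim_row M. \<forall>j<dim_col M.
     M $$ (i, j) = Min ((\<lambda>k. x k i + y k j) ` {..<r}))"

lemma is_min_of_rank1_iff:
  "is_min_of_rank1 M r \<longleftrightarrow> r \<ge> 1 \<and>
     (\<exists>X Y. (\<forall>k<r. X k \<in> carrier_mat (dim_row M) 1 \<and> Y k \<in> carrier_mat 1 (dim_col M)) \<and>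
        M = tropical_sum (dim_row M) (dim_col M) r (\<lambda>k. tropical_mult (X k) (Y k)))"
    (is "_ \<longleftrightarrow> _ \<and> (\<exists>X Y. ?Q X Y)")
proof (intro iffI conjI)
  assume "is_min_of_rank1 M r"
  then obtain x y where xy: "\<And>i j. i < dim_row M \<Longrightarrow> j < dim_col M \<Longrightarrow>
      M $$ (i, j) = Min ((\<lambda>k. x k i + y k j) ` {..<r})"
    unfolding is_min_of_rank1_def by blast
  let ?X = "\<lambda>k. mat (dim_row M) 1 (\<lambda>(i, _). x k i)"
  let ?Y = "\<lambda>k. mat 1 (dim_col M) (\<lambda>(_, j). y k j)"
  have "M = tropical_sum (dim_row M) (dim_col M) r (\<lambda>k. tropical_mult (?X k) (?Y k))"
  proof (rule eq_matI)
    fix i j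
    assume "i < dim_row (tropical_sum (dim_row M) (dim_col M) r (\<lambda>k. tropical_mult (?X k) (?Y k)))"
      and "j < dim_col (tropical_sum (dim_row M) (dim_col M) r (\<lambda>k. tropical_mult (?X k) (?Y k)))"
    then have ij: "i < dim_row M" "j < dim_col M" by (simp_all add: tropical_sum_def)
    then show "M $$ (i, j) = tropical_sum (dim_row M) (dim_col M) r (\<lambda>k. tropical_mult (?X k) (?Y k)) $$ (i, j)"
      by (simp add: xy tropical_sum_def tropical_mult_def lessThan_Suc)
  qed (simp_all add: tropical_sum_def)
  note M = this
  show "\<exists>X Y. ?Q X Y"
  proof (rule exI[of _ ?X], rule exI[of _ ?Y], rule conjI)
    show "\<forall>k<r. ?X k \<in> carrier_mat (dim_row M) 1 \<and> ?Y k \<in> carrier_mat 1 (dim_col M)" by simp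
  qed (rule M)
next
  assume "1 \<le> r \<and> (\<exists>X Y. ?Q X Y)"
  then obtain X Y where r: "r \<ge> 1" and carrier: "\<And>k. k < r \<Longrightarrow> X k \<in> carrier_mat (dim_row M) 1 \<and> Y k \<in> carrier_mat 1 (dim_col M)"
    and M: "M = tropical_sum (dim_row M) (dim_col M) r (\<lambda>k. tropical_mult (X k) (Y k))" by blast
  have "M $$ (i, j) = Min ((\<lambda>k. X k $$ (i, 0) + Y k $$ (0, j)) ` {..<r})"
    if ij: "i < dim_row M" "j < dim_col M" for i j
  proof -
    have "M $$ (i, j) = Min ((\<lambda>k. tropical_mult (X k) (Y k) $$ (i, j)) ` {..<r})"
      using arg_cong[OF M, of "\<lambda>A. A $$ (i, j)"] ij by (simp add: tropical_sum_def)
    also have "(\<lambda>k. tropical_mult (X k) (Y k) $$ (i, j)) ` {..<r} =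
        (\<lambda>k. X k $$ (i, 0) + Y k $$ (0, j)) ` {..<r}"
    proof (rule image_cong)
      fix k assume "k \<in> {..<r}"
      then have "dim_row (X k) = dim_row M" "dim_col (X k) = 1" "dim_col (Y k) = dim_col M"
        using carrier[of k] by auto
      then show "tropical_mult (X k) (Y k) $$ (i, j) = X k $$ (i, 0) + Y k $$ (0, j)"
        using ij by (simp add: tropical_mult_def lessThan_Suc)
    qed simp
    finally show ?thesis .
  qed
  then show "is_min_of_rank1 M r"
    unfolding is_min_of_rank1_def using r
    by (intro conjI exI[of _ "\<lambda>k i. X k $$ (i, 0)"] exI[of _ "\<lambda>k j. Y k $$ (0, j)"]) auto
qed (auto simp: is_min_of_rank1_def)

text \<open>Every matrix is the minimum of one rank-one matrix per column: the \<open>k\<close>-th one agrees with \<open>M\<close> in column \<open>k\<close>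
  and lies above it elsewhere, since a bound \<open>C\<close> on all differences of entries within a row is added to
  the other columns.\<close>

lemma is_min_of_dim_col_rank1:
  assumes "dim_col M \<ge> 1"
  shows "is_min_of_rank1 M (dim_col M)"
proof -
  let ?d = "dim_row M" and ?n = "dim_col M"
  let ?D = "(\<lambda>(i, j, k). M $$ (i, j) - M $$ (i, k)) ` ({..<?d} \<times> {..<?n} \<times> {..<?n})"
  have "finite ?D" by simp
  then obtain C where C: "\<And>z. z \<in> ?D \<Longrightarrow> z \<le> C" by (meson Max_ge)
  have bound: "M $$ (i, j) \<le> M $$ (i, k) + C" if "i < ?d" "j < ?n" "k < ?n" for i j k
    using C[of "M $$ (i, j) - M $$ (i, k)"] that by force
  have "M $$ (i, j) = Min ((\<lambda>k. M $$ (i, k) + (if j = k then 0 else C)) ` {..<?n})"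
    if "i < ?d" "j < ?n" for i j
    using that bound by (intro Min_eqI[symmetric]) (auto intro!: image_eqI[of _ _ j])
  then show ?thesis
    unfolding is_min_of_rank1_def using assms
    by (intro conjI exI[of _ "\<lambda>k i. M $$ (i, k)"] exI[of _ "\<lambda>k j. if j = k then 0 else C"]) auto
qed

lemma is_min_of_barvinok_rank:
  assumes "dim_col M \<ge> 1"
  shows "is_min_of_rank1 M (barvinok_rank M)"
  unfolding barvinok_rank_def is_min_of_rank1_iff[symmetric]
  using is_min_of_dim_col_rank1[OF assms] by (rule LeastI)

lemma lifts_through_if_min_of_rank1:
  assumes "is_min_of_rank1 M r"
  shows "lifts_through hahn_deg M r"
proof -
  obtain x y where r: "r \<ge> 1" and xy: "\<And>i j. i < dim_row M \<Longrightarrow> j < dim_col M \<Longrightarrow>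
      M $$ (i, j) = Min ((\<lambda>k. x k i + y k j) ` {..<r})"
    using assms unfolding is_min_of_rank1_def by blast
  have "{..<r} \<noteq> {}" using r by (simp add: lessThan_empty_iff)
  then show ?thesis
    unfolding lifts_through_def using xy hahn_deg_sum_monom[of "{..<r}"]
    by (intro exI[of _ "\<lambda>i c. hahn_monom (x c i)"] exI[of _ "\<lambda>c j. hahn_monom (y c j)"])
      (simp add: hahn_monom_mult)
qed

theorem kapranov_rank_le_barvinok_rank:
  "dim_col M \<ge> 1 \<Longrightarrow> kapranov_rank M \<le> barvinok_rank M"
  by (intro kapranov_rank_le lifts_through_if_min_of_rank1 is_min_of_barvinok_rank)

theorem tropical_rank_le_kapranov_rank:
  "dim_col M \<ge> 1 \<Longrightarrow> tropical_rank M \<le> kapranov_rank M"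
  by (rule hahn.tropical_rank_le[OF lifts_through_kapranov_rank[OF
      lifts_through_if_min_of_rank1[OF is_min_of_barvinok_rank]]])

section \<open>A matrix with Kapranov rank below Barvinok rank\<close>

text \<open>For a rank-one matrix the two diagonals of a \<open>2 \<times> 2\<close> block have equal sums. It lies above \<open>M\<close>, so if it attains
  \<open>M\<close> on one diagonal, the sum of \<open>M\<close> over the other diagonal cannot be larger.\<close>

lemma sum_le_if_attained_together:
  fixes r :: nat
  assumes M: "\<And>i j. i < d \<Longrightarrow> j < n \<Longrightarrow> M $$ (i, j) = Min ((\<lambda>k. x k i + y k j) ` {..<r})"
    and k: "k < r" and ij: "i < d" "j < n" "i' < d" "j' < n"
    and tight: "M $$ (i, j) = x k i + y k j" "M $$ (i', j') = x k i' + y k j'"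
  shows "M $$ (i, j') + M $$ (i', j) \<le> M $$ (i, j) + (M $$ (i', j') :: real)"
proof -
  have "M $$ (a, b) \<le> x k a + y k b" if "a < d" "b < n" for a b
    unfolding M[OF that] using k by (intro Min_le) auto
  from this[of i j'] this[of i' j] show ?thesis using ij tight by linarith
qed

text \<open>Any two of the zeros at \<open>(0,1)\<close>, \<open>(1,2)\<close>, \<open>(2,0)\<close> span a block whose other diagonal contains exactly one
  diagonal entry \<open>1\<close>, so they cannot be attained by the same rank-one matrix.\<close>

lemma barvinok_rank_one_mat_3: "3 \<le> barvinok_rank (1\<^sub>m 3 :: real mat)"
proof -
  let ?M = "(1\<^sub>m 3 :: real mat)" and ?r = "barvinok_rank (1\<^sub>m 3 :: real mat)"
  have dims: "dim_row ?M = 3" "dim_col ?M = 3" by (simp_all add: one_mat_def)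
  have "is_min_of_rank1 ?M ?r" by (rule is_min_of_barvinok_rank) (simp add: dims)
  then obtain x y where r: "?r \<ge> 1" and xy: "\<And>i j. i < 3 \<Longrightarrow> j < 3 \<Longrightarrow>
      ?M $$ (i, j) = Min ((\<lambda>k. x k i + y k j) ` {..<?r})"
    unfolding is_min_of_rank1_def dims by blast
  have "{..<?r} \<noteq> {}" using r by (simp add: lessThan_empty_iff)
  then have "?M $$ (i, j) \<in> (\<lambda>k. x k i + y k j) ` {..<?r}" if "i < 3" "j < 3" for i j
    unfolding xy[OF that] by (intro Min_in) auto
  then have "\<exists>k<?r. ?M $$ (i, j) = x k i + y k j" if "i < 3" "j < 3" for i j
    using that by (meson imageE lessThan_iff)
  then obtain k where k: "\<And>i j. i < 3 \<Longrightarrow> j < 3 \<Longrightarrow> k i j < ?r \<and> ?M $$ (i, j) = x (k i j) i + y (k i j) j"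
    by metis
  have differ: "k i j \<noteq> k i' j'"
    if "i < 3" "j < 3" "i' < 3" "j' < 3" "?M $$ (i, j) + ?M $$ (i', j') < ?M $$ (i, j') + ?M $$ (i', j)" for i j i' j'
    using sum_le_if_attained_together[of 3 3 ?M x y ?r "k i j" i j i' j', OF xy] k[of i j] k[of i' j'] that by force
  have "k 0 1 \<noteq> k 1 2" "k 1 2 \<noteq> k 2 0" "k 2 0 \<noteq> k 0 1"
    by (rule differ; simp add: one_mat_def)+
  moreover have "k 0 1 < ?r" "k 1 2 < ?r" "k 2 0 < ?r" using k by simp_all
  ultimately show ?thesis by linarith
qed

text \<open>The lift has the columns \<open>(t, 1, -1-t)\<close>, \<open>(1, t, -1-t)\<close> and \<open>(1, -1-t, t)\<close> in the plane of vectors with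
  coordinate sum \<open>0\<close>.\<close>

lemma kapranov_rank_one_mat_3: "kapranov_rank (1\<^sub>m 3 :: real mat) \<le> 2"
proof (rule kapranov_rank_le)
  let ?t = "hahn_monom 1"
  \<comment> \<open>The columns of \<open>P\<close> are \<open>(1, 0, -1)\<close> and \<open>(0, 1, -1)\<close>.\<close>
  define P :: "nat \<Rightarrow> nat \<Rightarrow> hahn" where "P i c = (if i = 2 then - 1 else if i = c then 1 else 0)" for i c
  define Q :: "nat \<Rightarrow> nat \<Rightarrow> hahn" where
    "Q c j = (if c = j then ?t else if j = 2 \<and> c = 1 then - 1 - ?t else 1)" for c j
  have units: "hahn_deg 1 = 0" "?t \<noteq> 0 \<and> hahn_deg ?t = 1" "-1 - ?t \<noteq> 0 \<and> hahn_deg (-1 - ?t) = 0"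
     "- ?t - 1 \<noteq> 0 \<and> hahn_deg (- ?t - 1) = 0"
    using hahn_degI[of 1 0] hahn_degI[of ?t 1] hahn_degI[of "-1 - ?t" 0] hahn_degI[of "- ?t - 1" 0] by simp_all
  show "lifts_through hahn_deg (1\<^sub>m 3 :: real mat) 2"
    unfolding lifts_through_def
  proof (intro exI allI impI)
    fix i j assume "i < dim_row (1\<^sub>m 3 :: real mat)" "j < dim_col (1\<^sub>m 3 :: real mat)"
    then have "i \<in> {0, 1, 2}" "j \<in> {0, 1, 2}" by (auto simp: one_mat_def)
    then show "(\<Sum>c<2. P i c * Q c j) \<noteq> 0 \<and>
        hahn_deg (\<Sum>c<2. P i c * Q c j) = (1\<^sub>m 3 :: real mat) $$ (i, j)"
      using units by (auto simp: P_def Q_def one_mat_def numeral_2_eq_2)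
  qed
qed

section \<open>A matrix with tropical rank below Kapranov rank\<close>

interpretation two_adic: valuation "\<lambda>x::int. real (multiplicity 2 x)"
proof
  fix x y :: int assume nz: "x \<noteq> 0" "y \<noteq> 0"
  show "real (multiplicity 2 (x * y)) = real (multiplicity 2 x) + real (multiplicity 2 y)"
    using nz by (simp add: prime_elem_multiplicity_mult_distrib)
  show "min (real (multiplicity 2 x)) (real (multiplicity 2 y)) \<le> real (multiplicity 2 (x + y))"
    if "x + y \<noteq> 0"
  proof -
    let ?m = "min (multiplicity 2 x) (multiplicity 2 y)"
    have "2 ^ ?m dvd x" "2 ^ ?m dvd y" by (simp_all add: multiplicity_dvd')
    then have "2 ^ ?m dvd x + y" by (rule dvd_add)
    then have "?m \<le> multiplicity 2 (x + y)" using that by (intro multiplicity_geI) auto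
    then show ?thesis by linarith
  qed
qed

text \<open>Modulo \<open>2\<close> these are the seven points and the seven lines of the Fano plane in homogeneous coordinates; point
  \<open>i\<close> lies on line \<open>j\<close> if the product is even. The integer representatives are chosen so that no product is
  divisible by \<open>4\<close>: every even product then has \<open>2\<close>-adic valuation exactly \<open>1\<close>. Representatives in \<open>{0, 1}\<close> do
  not have this property, because they produce zeros.\<close>

definition fano_point :: "nat \<Rightarrow> nat \<Rightarrow> int" where
  "fano_point i c = [[1,2,0], [0,1,2], [2,0,1], [1,1,0], [1,0,1], [0,1,1], [1,1,1]] ! i ! c"

definition fano_line :: "nat \<Rightarrow> nat \<Rightarrow> int" where
  "fano_line c j = [[2,0,1], [0,1,2], [1,2,0], [0,1,1], [1,0,1], [1,1,0], [1,1,1]] ! j ! c"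

definition fano_matrix :: "real mat" where
  "fano_matrix = mat 7 7 (\<lambda>(i, j). if even (\<Sum>c<3. fano_point i c * fano_line c j) then 1 else 0)"

lemma sum_lessThan_3: "(\<Sum>c<3::nat. f c) = f 0 + f 1 + (f 2 :: 'a::comm_monoid_add)"
  by (simp add: numeral_3_eq_3 numeral_2_eq_2 add.assoc)

lemma less_7: "i < 7 \<longleftrightarrow> i \<in> {0, 1, 2, 3, 4, 5, 6 :: nat}"
  by auto

lemma fano_products:
  assumes "i < 7" "j < 7"
  shows "(\<Sum>c<3. fano_point i c * fano_line c j) \<in> {1, 2, 3, 5}"
  using assms unfolding less_7 sum_lessThan_3
  by (auto simp: fano_point_def fano_line_def)

lemma tropical_rank_fano_matrix: "tropical_rank fano_matrix \<le> 3"
proof (rule two_adic.tropical_rank_le)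
  show "lifts_through (\<lambda>x::int. real (multiplicity 2 x)) fano_matrix 3"
    unfolding lifts_through_def
  proof (rule exI[of _ fano_point], rule exI[of _ fano_line], intro allI impI)
    fix i j assume "i < dim_row fano_matrix" "j < dim_col fano_matrix"
    then have ij: "i < 7" "j < 7" by (simp_all add: fano_matrix_def)
    let ?a = "\<Sum>c<3. fano_point i c * fano_line c j"
    have "multiplicity 2 ?a = (if even ?a then 1 else 0)" "?a \<noteq> 0"
      using fano_products[OF ij] by (auto simp: not_dvd_imp_multiplicity_0)
    then show "?a \<noteq> 0 \<and> real (multiplicity 2 ?a) = fano_matrix $$ (i, j)"
      using ij by (simp add: fano_matrix_def)
  qed
qed

lemma hahn_coeff_prod_0:
  assumes "finite I" "\<And>i x. i \<in> I \<Longrightarrow> x < 0 \<Longrightarrow> hahn_coeff (f i) x = 0"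
  shows "hahn_coeff (\<Prod>i\<in>I. f i) 0 = (\<Prod>i\<in>I. hahn_coeff (f i) 0) \<and>
    (\<forall>x<0. hahn_coeff (\<Prod>i\<in>I. f i) x = 0)"
  using assms
proof (induction I rule: finite_induct)
  case (insert i I)
  have low: "hahn_coeff (f i) x = 0" "hahn_coeff (\<Prod>i\<in>I. f i) x = 0" if "x < 0" for x
    using insert that by auto
  show ?case
    using hahn_coeff_mult_low[of 0 "f i" 0 "\<Prod>i\<in>I. f i", OF low] insert by simp
qed simp

text \<open>On series without negative exponents, taking the constant coefficient is a ring homomorphism.\<close>

lemma hahn_coeff_det_0:
  assumes G: "G \<in> carrier_mat r r"
    and low: "\<And>i j x. i < r \<Longrightarrow> j < r \<Longrightarrow> x < 0 \<Longrightarrow> hahn_coeff (G $$ (i, j)) x = 0"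
  shows "hahn_coeff (det G) 0 = det (map_mat (\<lambda>f. hahn_coeff f 0) G)"
proof -
  have sgn: "hahn_coeff (signof \<pi> * f) 0 = signof \<pi> * hahn_coeff f 0" for \<pi> :: "nat \<Rightarrow> nat" and f
    by (simp add: sign_def)
  have G0: "map_mat (\<lambda>f. hahn_coeff f 0) G \<in> carrier_mat r r" using G by simp
  have coeff: "hahn_coeff (signof \<pi> * (\<Prod>i = 0..<r. G $$ (i, \<pi> i))) 0 =
      signof \<pi> * (\<Prod>i = 0..<r. map_mat (\<lambda>f. hahn_coeff f 0) G $$ (i, \<pi> i))"
    if "\<pi> permutes {0..<r}" for \<pi>
  proof -
    have \<pi>: "\<pi> i < r" if "i < r" for i
      using permutes_in_image[OF \<open>\<pi> permutes _\<close>, of i] that by simp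
    have "hahn_coeff (\<Prod>i = 0..<r. G $$ (i, \<pi> i)) 0 = (\<Prod>i = 0..<r. hahn_coeff (G $$ (i, \<pi> i)) 0)"
      using low \<pi> by (intro conjunct1[OF hahn_coeff_prod_0]) auto
    also have "\<dots> = (\<Prod>i = 0..<r. map_mat (\<lambda>f. hahn_coeff f 0) G $$ (i, \<pi> i))"
      using G \<pi> by (intro prod.cong) auto
    finally show ?thesis by (simp only: sgn)
  qed
  show ?thesis
    unfolding det_def'[OF G] det_def'[OF G0] hahn_coeff_sum by (rule sum.cong) (simp_all only: coeff mem_Collect_eq)
qed

text \<open>The Schur complement of the diagonal block vanishes: a kernel vector is determined by its last entry, and
  the last row then yields the equation.\<close>

lemma bordered_diagonal_singular:
  fixes G :: "nat \<Rightarrow> nat \<Rightarrow> 'a::field"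
  assumes det: "det (mat (Suc n) (Suc n) (\<lambda>(a, b). G a b)) = 0"
    and diag: "\<And>a. a < n \<Longrightarrow> G a a \<noteq> 0"
    and off: "\<And>a b. a < n \<Longrightarrow> b < n \<Longrightarrow> a \<noteq> b \<Longrightarrow> G a b = 0"
  shows "G n n = (\<Sum>a<n. G n a / G a a * G a n)"
proof -
  let ?G = "mat (Suc n) (Suc n) (\<lambda>(a, b). G a b)"
  have "\<exists>v. v \<in> carrier_vec (Suc n) \<and> v \<noteq> 0\<^sub>v (Suc n) \<and> ?G *\<^sub>v v = 0\<^sub>v (Suc n)"
    using det by (subst det_0_iff_vec_prod_zero[symmetric]) simp_all
  then obtain v where v: "v \<in> carrier_vec (Suc n)" "v \<noteq> 0\<^sub>v (Suc n)" "?G *\<^sub>v v = 0\<^sub>v (Suc n)"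
    by blast
  have row: "(\<Sum>b<n. G a b * v $ b) + G a n * v $ n = 0" if "a \<le> n" for a
    using arg_cong[OF v(3), of "\<lambda>u. u $ a"] that v(1) by (simp add: scalar_prod_def atLeast0LessThan)
  have va: "v $ a = - (G a n / G a a) * v $ n" if "a < n" for a
  proof -
    have "(\<Sum>b<n. G a b * v $ b) = (\<Sum>b\<in>{a}. G a b * v $ b)"
      using that off by (intro sum.mono_neutral_right) auto
    then have "G a a * v $ a + G a n * v $ n = 0" using row[of a] that by simp
    then show ?thesis using diag[OF that] by (simp add: field_simps eq_neg_iff_add_eq_0)
  qed
  have vn: "v $ n \<noteq> 0"
  proof
    assume "v $ n = 0"
    then have "v = 0\<^sub>v (Suc n)" using va v(1) by (intro eq_vecI) (auto simp: less_Suc_eq)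
    then show False using v(2) by simp
  qed
  have "(\<Sum>b<n. G n b * v $ b) = (\<Sum>b<n. - (G n b / G b b * G b n * v $ n))"
    by (intro sum.cong) (simp_all add: va)
  then have "(\<Sum>b<n. G n b * v $ b) = - (\<Sum>a<n. G n a / G a a * G a n) * v $ n"
    by (simp add: sum_distrib_right sum_negf)
  then have "(G n n - (\<Sum>a<n. G n a / G a a * G a n)) * v $ n = 0"
    using row[of n] by (simp add: algebra_simps)
  then show ?thesis using vn by simp
qed

text \<open>In the plane, two vectors \<open>(a, b)\<close> and \<open>(a', b')\<close> orthogonal to the same nonzero vector are parallel.\<close>

lemma proportional:
  fixes a b :: "'a::field"
  assumes "a * x + b * y = 0" "a' * x + b' * y = 0" "a * s + b * t = 0" "a \<noteq> 0" "y \<noteq> 0"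
  shows "a' * s + b' * t = 0"
proof -
  have "(a * (a' * s + b' * t)) * y =
      a' * y * (a * s + b * t) + a * t * (a' * x + b' * y) - a' * t * (a * x + b * y)"
    by (simp add: algebra_simps)
  also have "\<dots> = 0" using assms(1-3) by simp
  finally have "(a * (a' * s + b' * t)) * y = 0" .
  then show ?thesis using assms by simp
qed

text \<open>In a matrix of rank \<open>3\<close>, the rows \<open>0\<close>, \<open>1\<close>, \<open>2\<close> form a basis of the row space, since the columns \<open>2\<close>, \<open>1\<close>, \<open>0\<close> cut a
  nonsingular diagonal block out of them. Geometrically, points \<open>0\<close>, \<open>1\<close>, \<open>2\<close> and \<open>6\<close> form a quadrangle, and \<open>3\<close>,
  \<open>4\<close>, \<open>5\<close> are its diagonal points. Each diagonal point lies on a line with point \<open>6\<close> and one of the basis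
  points, which forces its coordinates to be proportional to two coordinates of point \<open>6\<close>. Collinearity
  of the diagonal points on line \<open>6\<close> says \<open>u + v = u + w = v + w = 0\<close> for the three nonzero terms \<open>u\<close>, \<open>v\<close>, \<open>w\<close> of
  the product of point \<open>6\<close> with line \<open>6\<close>, hence \<open>2 * u = 0\<close>.\<close>

lemma fano_not_realizable:
  fixes C :: "nat \<Rightarrow> nat \<Rightarrow> 'a::field"
  assumes char: "(2 :: 'a) \<noteq> 0"
    and incidence: "\<And>i j. i < 7 \<Longrightarrow> j < 7 \<Longrightarrow> C i j = 0 \<longleftrightarrow> even (\<Sum>c<3. fano_point i c * fano_line c j)"
    and minors: "\<And>p q. (\<And>a. a < 4 \<Longrightarrow> p a < 7 \<and> q a < 7) \<Longrightarrow> det (mat 4 4 (\<lambda>(a, b). C (p a) (q b))) = 0"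
  shows False
proof -
  note inc = incidence sum_lessThan_3 fano_point_def fano_line_def
  \<comment> \<open>The \<open>c\<close>-th coordinate of point \<open>i\<close>, read off in column \<open>2 - c\<close>, where only
    basis row \<open>c\<close> is nonzero.\<close>
  define e where "e i c = C i (2 - c) / C c (2 - c)" for i c
  have coord: "C i j = e i 0 * C 0 j + e i 1 * C 1 j + e i 2 * C 2 j" if ij: "i < 7" "j < 7" for i j
  proof -
    define p where "p a = (if a < 3 then a else i)" for a :: nat
    define q where "q b = (if b < 3 then 2 - b else j)" for b :: nat
    have "det (mat 4 4 (\<lambda>(a, b). C (p a) (q b))) = 0"
      by (rule minors) (use ij in \<open>auto simp: p_def q_def\<close>)
    then have "det (mat (Suc 3) (Suc 3) (\<lambda>(a, b). C (p a) (q b))) = 0" by simp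
    moreover have "C (p a) (q a) \<noteq> 0" if "a < 3" for a
    proof -
      have "a \<in> {0, 1, 2}" using that by auto
      then show ?thesis by (auto simp: p_def q_def inc)
    qed
    moreover have "C (p a) (q b) = 0" if "a < 3" "b < 3" "a \<noteq> b" for a b
    proof -
      have "a \<in> {0, 1, 2}" "b \<in> {0, 1, 2}" using that by auto
      then show ?thesis using \<open>a \<noteq> b\<close> by (auto simp: p_def q_def inc)
    qed
    ultimately have "C (p 3) (q 3) = (\<Sum>a<3. C (p 3) (q a) / C (p a) (q a) * C (p a) (q 3))"
      by (rule bordered_diagonal_singular)
    then show ?thesis by (simp add: sum_lessThan_3 p_def q_def e_def)
  qed
  have e0: "e 3 2 = 0" "e 4 1 = 0" "e 5 0 = 0" by (simp_all add: e_def inc)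
  have e: "e 3 0 \<noteq> 0" "e 4 0 \<noteq> 0" "e 5 1 \<noteq> 0" "e 6 0 \<noteq> 0" by (simp_all add: e_def inc)
  have C0: "C 3 6 = 0" "C 4 6 = 0" "C 5 6 = 0" "C 6 3 = 0" "C 6 4 = 0" "C 6 5 = 0"
      "C 3 5 = 0" "C 4 4 = 0" "C 5 3 = 0" "C 0 3 = 0" "C 1 4 = 0" "C 2 5 = 0"
    by (simp_all add: inc)
  have C: "C 1 5 \<noteq> 0" "C 2 4 \<noteq> 0" "C 2 3 \<noteq> 0" "C 0 6 \<noteq> 0" by (simp_all add: inc)
  have "e 6 0 * C 0 6 + e 6 1 * C 1 6 = 0"
    by (rule proportional[of "e 3 0" "C 0 5" "e 3 1" "C 1 5"])
      (use coord[of 3 5] coord[of 6 5] coord[of 3 6] e0 C0 e C in simp_all)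
  moreover have "e 6 0 * C 0 6 + e 6 2 * C 2 6 = 0"
    by (rule proportional[of "e 4 0" "C 0 4" "e 4 2" "C 2 4"])
      (use coord[of 4 4] coord[of 6 4] coord[of 4 6] e0 C0 e C in simp_all)
  moreover have "e 6 1 * C 1 6 + e 6 2 * C 2 6 = 0"
    by (rule proportional[of "e 5 1" "C 1 3" "e 5 2" "C 2 3"])
      (use coord[of 5 3] coord[of 6 3] coord[of 5 6] e0 C0 e C in simp_all)
  moreover have "2 * (e 6 0 * C 0 6) = (e 6 0 * C 0 6 + e 6 1 * C 1 6) +
      (e 6 0 * C 0 6 + e 6 2 * C 2 6) - (e 6 1 * C 1 6 + e 6 2 * C 2 6)"
    by (simp add: algebra_simps)
  ultimately have "2 * (e 6 0 * C 0 6) = 0" by simp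
  then show False using char e C by simp
qed

text \<open>The constant coefficients of a lift of rank at most \<open>3\<close> would realize the Fano plane over the complex
  numbers: an entry of degree \<open>0\<close> has nonzero constant coefficient, an entry of degree \<open>1\<close> has none.\<close>

lemma kapranov_rank_fano_matrix: "3 < kapranov_rank fano_matrix"
proof (rule ccontr)
  let ?k = "kapranov_rank fano_matrix"
  assume "\<not> 3 < ?k"
  have dims: "dim_row fano_matrix = 7" "dim_col fano_matrix = 7" by (simp_all add: fano_matrix_def)
  have "lifts_through hahn_deg fano_matrix ?k"
    by (rule lifts_through_kapranov_rank[OF lifts_through_if_min_of_rank1[OF is_min_of_barvinok_rank]])
      (simp add: dims)
  then obtain P Q where PQ: "\<And>i j. i < 7 \<Longrightarrow> j < 7 \<Longrightarrow>
      (\<Sum>c<?k. P i c * Q c j) \<noteq> 0 \<and> hahn_deg (\<Sum>c<?k. P i c * Q c j) = fano_matrix $$ (i, j)"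
    unfolding lifts_through_def dims by (elim exE) blast
  define F where "F i j = (\<Sum>c<?k. P i c * Q c j)" for i j
  define C where "C i j = hahn_coeff (F i j) 0" for i j
  have F: "F i j \<noteq> 0 \<and> hahn_deg (F i j) = fano_matrix $$ (i, j)" if "i < 7" "j < 7" for i j
    using PQ[OF that] by (simp add: F_def)
  have low: "hahn_coeff (F i j) x = 0" if "i < 7" "j < 7" "x < 0" for i j x
    using F[OF that(1,2)] that by (intro hahn_coeff_below_deg) (auto simp: fano_matrix_def)
  show False
  proof (rule fano_not_realizable[of C])
    fix i j :: nat assume ij: "i < 7" "j < 7"
    show "C i j = 0 \<longleftrightarrow> even (\<Sum>c<3. fano_point i c * fano_line c j)"
      using F[OF ij] hahn_deg(1)[of "F i j"] hahn_coeff_below_deg[of "F i j" 0] ij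
      by (cases "even (\<Sum>c<3. fano_point i c * fano_line c j)") (simp_all add: C_def fano_matrix_def)
  next
    fix p q :: "nat \<Rightarrow> nat" assume pq: "\<And>a. a < 4 \<Longrightarrow> p a < 7 \<and> q a < 7"
    let ?G = "mat 4 4 (\<lambda>(a, b). F (p a) (q b))"
    have "?G = mat 4 4 (\<lambda>(a, b). \<Sum>c<?k. P (p a) c * Q c (q b))" by (simp add: F_def)
    then have "det ?G = 0"
      using det_product_of_small_inner_dim[of ?k 4 "\<lambda>a. P (p a)" "\<lambda>c b. Q c (q b)"] \<open>\<not> 3 < ?k\<close> by simp
    then have "det (map_mat (\<lambda>f. hahn_coeff f 0) ?G) = 0"
      using hahn_coeff_det_0[of ?G 4] low pq by simp
    moreover have "map_mat (\<lambda>f. hahn_coeff f 0) ?G = mat 4 4 (\<lambda>(a, b). C (p a) (q b))"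
      by (intro eq_matI) (auto simp: C_def)
    ultimately show "det (mat 4 4 (\<lambda>(a, b). C (p a) (q b))) = 0" by simp
  qed simp
qed

theorem theorem1p4:
  shows "(\<forall>M :: real mat. dim_row M \<ge> 1 \<and> dim_col M \<ge> 1 \<longrightarrow>
            tropical_rank M \<le> kapranov_rank M \<and> kapranov_rank M \<le> barvinok_rank M) \<and>
         (\<exists>M :: real mat. dim_row M \<ge> 1 \<and> dim_col M \<ge> 1 \<and> tropical_rank M < kapranov_rank M) \<and>
         (\<exists>M :: real mat. dim_row M \<ge> 1 \<and> dim_col M \<ge> 1 \<and> kapranov_rank M < barvinok_rank M)"
proof (intro conjI)
  show "\<forall>M :: real mat. dim_row M \<ge> 1 \<and> dim_col M \<ge> 1 \<longrightarrow>
      tropical_rank M \<le> kapranov_rank M \<and> kapranov_rank M \<le> barvinok_rank M"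
    using tropical_rank_le_kapranov_rank kapranov_rank_le_barvinok_rank by blast
  show "\<exists>M :: real mat. dim_row M \<ge> 1 \<and> dim_col M \<ge> 1 \<and> tropical_rank M < kapranov_rank M"
    using tropical_rank_fano_matrix kapranov_rank_fano_matrix
    by (intro exI[of _ fano_matrix]) (auto simp: fano_matrix_def)
  show "\<exists>M :: real mat. dim_row M \<ge> 1 \<and> dim_col M \<ge> 1 \<and> kapranov_rank M < barvinok_rank M"
    using kapranov_rank_one_mat_3 barvinok_rank_one_mat_3
    by (intro exI[of _ "1\<^sub>m 3"]) (auto simp: one_mat_def)
qed

end
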